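(* Let $n\geqslant 2$ and let $J$ be a complex $n\times n$ matrix of the Jordan form $$J=\bigoplus_{l=1}^s J_{\lambda_l}^{k_l},\qquad k_1+\cdots+k_s=n,$$ where $J_{\lambda}^{k}$ denotes the $k\times k$ Jordan block with eigenvalue $\lambda$ (entries $\lambda$ on the main diagonal, $1$ on the superdiagonal, $0$ elsewhere). Suppose that $J$ is not proportional to the unit matrix, i.e. $J\notin\langle E^n\rangle$. Let $\boldsymbol{\varphi}^m=(\varphi^{m1}(t),\dots,\varphi^{mn}(t))^{\rm T}$, $m=1,\dots,2n$, form a fundamental set of solutions of the system $\ddot{\boldsymbol{x}}=J\boldsymbol{x}$ for the unknown vector-function $\boldsymbol{x}(t)=(x^1(t),\dots,x^n(t))^{\rm T}$. Let $H^\ell$, $\ell=1,\dots,N$, exhaust the linearly independent $n\times n$ matrices that commute with $J$ (i.e. they form a basis of the space of complex $n\times n$ matrices commuting with $J$). Let $$\gamma=(\gamma^{ab})=\operatorname{diag}(1,2,\dots,k_1,\,1,2,\dots,k_2,\,\dots,\,1,2,\dots,k_s).$$ Define the vector fields (with summation over repeated indices $a,b=1,\dots,n$) $$\mathcal X^m=\varphi^{ma}(t)\,\partial_{x^a},\qquad \mathcal H^\ell=(H^\ell)^{ba}x^a\,\partial_{x^b},\qquad \mathcal T=\partial_t,\qquad \mathcal D=t\,\partial_t-2\gamma^{ab}x^b\,\partial_{x^a}.$$ Then the maximal Lie invariance algebra $\mathfrak g^J$ of the system $\ddot{\boldsymbol{x}}=J\boldsymbol{x}$ is $$\langle \mathcal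 X^m,\ m=1,\dots,2n,\ \ \mathcal H^\ell,\ \ell=1,\dots,N,\ \ \mathcal T\rangle$$ if $J$ is non-nilpotent, and $$\langle \mathcal X^m,\ m=1,\dots,2n,\ \ \mathcal H^\ell,\ \ell=1,\dots,N,\ \ \mathcal T,\ \mathcal D\rangle$$ if $J$ is nilpotent.
   Context: The underlying field is $\mathbb C$. $E^n$ is the $n\times n$ unit matrix, and $\langle\cdots\rangle$ denotes the linear span over $\mathbb C$; in particular the zero matrix belongs to $\langle E^n\rangle$. A dot denotes $d/dt$. Maximal Lie invariance algebra. For a system $\ddot{\boldsymbol{x}}=\boldsymbol{F}(t,\boldsymbol{x},\dot{\boldsymbol{x}})$ of $n$ second-order ordinary differential equations, consider vector fields $Q=\xi(t,\boldsymbol{x})\partial_t+\eta^a(t,\boldsymbol{x})\partial_{x^a}$ (summation over $a=1,\dots,n$) with smooth coefficients (holomorphic in the complex setting). Write $v^a=\dot x^a$, $D_t=\partial_t+v^a\partial_{x^a}+\ddot x^a\partial_{v^a}$, $\eta^b_{(1)}=D_t\eta^b-v^bD_t\xi$, $\eta^b_{(2)}=D_t\eta^b_{(1)}-\ddot x^bD_t\xi$. The field $Q$ is a Lie symmetry vector field of the system if, for $b=1,\dots,n$, after the substitution $\ddot{\boldsymbol{x}}=\boldsymbol{F}$ one has $$\eta^b_{(2)}=\xi F^b_t+\eta^aF^b_{x^a}+\eta^a_{(1)}F^b_{v^a}$$ identically in $(t,\boldsymbol{x},\boldsymbol{v})$. The maximal Lie invariance algebra of the system is the Lie algebra of all its Lie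 symmetry vector fields. For the system $\ddot{\boldsymbol{x}}=J\boldsymbol{x}$ one takes $\boldsymbol{F}=J\boldsymbol{x}$. *)

theory Defs
  imports
    "Jordan_Normal_Form.Jordan_Normal_Form"
    "HOL-Library.Function_Algebras"
    "HOL-Complex_Analysis.Complex_Analysis"
begin

no_notation Matrix.vec_index (infixl \<open>$\<close> 100)


section \<open>Complex linear structures\<close>

text \<open>
  The types below carry only real vector space classes, so the scalar multiplications over
  \<open>complex\<close> are introduced explicitly, and linear span and independence over \<open>complex\<close> are obtained
  by interpreting the locale \<^locale>\<open>vector_space\<close>.
\<close>

definition matscale :: "complex \<Rightarrow> complex^'n^'n \<Rightarrow> complex^'n^'n" where
  "matscale c A = (\<chi> i j. c * A $ i $ j)"

interpretation cmat: vector_space "matscale :: complex \<Rightarrow> complex^'n^'n \<Rightarrow> complex^'n^'n"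
  by unfold_locales (simp_all add: matscale_def vec_eq_iff algebra_simps)

definition curvescale :: "complex \<Rightarrow> (complex \<Rightarrow> complex^'n) \<Rightarrow> (complex \<Rightarrow> complex^'n)" where
  "curvescale c \<phi> = (\<lambda>t. c *s \<phi> t)"

interpretation ccurve:
  vector_space "curvescale :: complex \<Rightarrow> (complex \<Rightarrow> complex^'n) \<Rightarrow> (complex \<Rightarrow> complex^'n)"
  by unfold_locales (simp_all add: curvescale_def fun_eq_iff vec_eq_iff algebra_simps)

definition pointscale :: "complex \<Rightarrow> complex \<times> (complex^'n) \<Rightarrow> complex \<times> (complex^'n)" where
  "pointscale c p = (c * fst p, c *s snd p)"

text \<open>
  A vector field \<open>\<xi>(t,x)\<partial>\<^sub>t + \<eta>\<^sup>a(t,x)\<partial>\<^bsub>x\<^sup>a\<^esub>\<close> is the map sending \<open>(t, x)\<close> to \<open>(\<xi>(t,x), \<eta>(t,x))\<close>.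
\<close>

type_synonym 'n vfield = "complex \<times> (complex^'n) \<Rightarrow> complex \<times> (complex^'n)"

definition vfscale :: "complex \<Rightarrow> 'n::finite vfield \<Rightarrow> 'n vfield" where
  "vfscale c Q = (\<lambda>p. pointscale c (Q p))"

interpretation vf: vector_space "vfscale :: complex \<Rightarrow> 'n::finite vfield \<Rightarrow> 'n vfield"
  by unfold_locales
    (simp_all add: vfscale_def pointscale_def fun_eq_iff prod_eq_iff vec_eq_iff algebra_simps)


section \<open>Lie symmetries of systems of second-order equations\<close>

text \<open>
  Vector fields over a domain \<open>\<Omega>\<close> are represented by total functions that vanish outside \<open>\<Omega>\<close>, so that
  equality on \<open>\<Omega>\<close> is equality of functions.
\<close>

definition vf_on :: "(complex \<times> (complex^'n)) set \<Rightarrow> 'n::finite vfield \<Rightarrow> 'n vfield" where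
  "vf_on \<Omega> Q = (\<lambda>p. if p \<in> \<Omega> then Q p else 0)"

text \<open>
  Holomorphy in several variables: the Frechet derivative exists at each point and is linear over
  \<open>complex\<close>.
\<close>

definition holomorphic_vf :: "(complex \<times> (complex^'n)) set \<Rightarrow> 'n::finite vfield \<Rightarrow> bool" where
  "holomorphic_vf \<Omega> Q \<longleftrightarrow>
     (\<forall>p\<in>\<Omega>. \<exists>Q'. (Q has_derivative Q') (at p) \<and>
        (\<forall>c h. Q' (pointscale c h) = pointscale c (Q' h)))"

text \<open>Functions on the space with coordinates \<open>(t, x, v)\<close>, where \<open>v\<close> stands for the derivative of \<open>x\<close>.\<close>

type_synonym ('n, 'b) jetfun =
  "complex \<Rightarrow> complex^'n \<Rightarrow> complex^'n \<Rightarrow> 'b"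

definition pd_t :: "('n::finite, complex) jetfun \<Rightarrow> ('n, complex) jetfun" where
  "pd_t f t x v = deriv (\<lambda>s. f s x v) t"

definition pd_x :: "'n::finite \<Rightarrow> ('n, complex) jetfun \<Rightarrow> ('n, complex) jetfun" where
  "pd_x a f t x v = deriv (\<lambda>z. f t (x + axis a z) v) 0"

definition pd_v :: "'n::finite \<Rightarrow> ('n, complex) jetfun \<Rightarrow> ('n, complex) jetfun" where
  "pd_v a f t x v = deriv (\<lambda>z. f t x (v + axis a z)) 0"

text \<open>
  The operator \<open>D\<^sub>t = \<partial>\<^sub>t + v\<^sup>a\<partial>\<^bsub>x\<^sup>a\<^esub> + w\<^sup>a\<partial>\<^bsub>v\<^sup>a\<^esub>\<close>. The parameter \<open>w\<close> is the value of the second derivative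
  of \<open>x\<close>; it is a coordinate independent of \<open>t\<close>, \<open>x\<close> and \<open>v\<close>, so it is held fixed when derivatives
  are taken and is replaced by the right-hand side of the system only afterwards.
\<close>

definition total_deriv ::
    "complex^'n \<Rightarrow> ('n::finite, complex) jetfun \<Rightarrow> ('n, complex) jetfun" where
  "total_deriv w f t x v =
     pd_t f t x v + (\<Sum>a\<in>UNIV. v $ a * pd_x a f t x v) + (\<Sum>a\<in>UNIV. w $ a * pd_v a f t x v)"

definition xi :: "'n::finite vfield \<Rightarrow> ('n, complex) jetfun" where
  "xi Q t x v = fst (Q (t, x))"

definition eta :: "'n::finite vfield \<Rightarrow> 'n \<Rightarrow> ('n, complex) jetfun" where
  "eta Q b t x v = snd (Q (t, x)) $ b"

text \<open>
  The coefficients of the first and second prolongations. The first one does not depend on \<open>w\<close>,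
  since \<^const>\<open>xi\<close> and \<^const>\<open>eta\<close> do not depend on \<open>v\<close>.
\<close>

definition eta1 :: "complex^'n \<Rightarrow> 'n::finite vfield \<Rightarrow> 'n \<Rightarrow> ('n, complex) jetfun" where
  "eta1 w Q b t x v = total_deriv w (eta Q b) t x v - v $ b * total_deriv w (xi Q) t x v"

definition eta2 :: "complex^'n \<Rightarrow> 'n::finite vfield \<Rightarrow> 'n \<Rightarrow> ('n, complex) jetfun" where
  "eta2 w Q b t x v = total_deriv w (eta1 w Q b) t x v - w $ b * total_deriv w (xi Q) t x v"

definition lie_symmetry ::
    "(complex \<times> (complex^'n)) set \<Rightarrow> ('n::finite, complex^'n) jetfun \<Rightarrow> 'n vfield \<Rightarrow> bool" where
  "lie_symmetry \<Omega> F Q \<longleftrightarrow>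
     (\<forall>t x v b. (t, x) \<in> \<Omega> \<longrightarrow>
        eta2 (F t x v) Q b t x v =
          xi Q t x v * pd_t (\<lambda>t x v. F t x v $ b) t x v
          + (\<Sum>a\<in>UNIV. eta Q a t x v * pd_x a (\<lambda>t x v. F t x v $ b) t x v)
          + (\<Sum>a\<in>UNIV. eta1 (F t x v) Q a t x v * pd_v a (\<lambda>t x v. F t x v $ b) t x v))"

definition max_lie_invariance_algebra ::
    "(complex \<times> (complex^'n)) set \<Rightarrow> ('n::finite, complex^'n) jetfun \<Rightarrow> 'n vfield set" where
  "max_lie_invariance_algebra \<Omega> F =
     {Q. (\<forall>p. p \<notin> \<Omega> \<longrightarrow> Q p = 0) \<and> holomorphic_vf \<Omega> Q \<and> lie_symmetry \<Omega> F Q}"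


section \<open>Solutions and linear systems\<close>

definition is_solution ::
    "('n::finite, complex^'n) jetfun \<Rightarrow> (complex \<Rightarrow> complex^'n) \<Rightarrow> bool" where
  "is_solution F \<phi> \<longleftrightarrow>
     (\<forall>a. (\<lambda>t. \<phi> t $ a) holomorphic_on UNIV) \<and>
     (\<forall>t a. (deriv ^^ 2) (\<lambda>s. \<phi> s $ a) t = F t (\<phi> t) (\<chi> b. deriv (\<lambda>s. \<phi> s $ b) t) $ a)"

definition fundamental_set ::
    "('n::finite, complex^'n) jetfun \<Rightarrow> (nat \<Rightarrow> complex \<Rightarrow> complex^'n) \<Rightarrow> bool" where
  "fundamental_set F \<phi> \<longleftrightarrow>
     (\<forall>m\<in>{1..2 * CARD('n)}. is_solution F (\<phi> m)) \<and>
     inj_on \<phi> {1..2 * CARD('n)} \<and> ccurve.independent (\<phi> ` {1..2 * CARD('n)})"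

definition linear_rhs :: "complex^'n^'n \<Rightarrow> ('n::finite, complex^'n) jetfun" where
  "linear_rhs J t x v = J *v x"

definition commutant_basis :: "complex^'n^'n \<Rightarrow> nat \<Rightarrow> (nat \<Rightarrow> complex^'n^'n) \<Rightarrow> bool" where
  "commutant_basis J N H \<longleftrightarrow>
     inj_on H {1..N} \<and> cmat.independent (H ` {1..N}) \<and>
     cmat.span (H ` {1..N}) = {A. A ** J = J ** A}"

definition nilpotent_matrix :: "complex^'n^'n \<Rightarrow> bool" where
  "nilpotent_matrix J \<longleftrightarrow> (\<exists>k. ((\<lambda>A. J ** A) ^^ k) (Finite_Cartesian_Product.mat 1) = 0)"

text \<open>
  The list \<open>bl\<close> consists of the pairs \<open>(k\<^sub>l, \<lambda>\<^sub>l)\<close>, and \<open>pos\<close> numbers the coordinates from \<open>0\<close>, in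
  accordance with the indexing of \<^const>\<open>jordan_matrix\<close>.
\<close>

definition jordan_form :: "('n \<Rightarrow> nat) \<Rightarrow> (nat \<times> complex) list \<Rightarrow> complex^'n^'n" where
  "jordan_form pos bl = (\<chi> a b. jordan_matrix bl $$ (pos a, pos b))"

definition gamma_matrix :: "('n \<Rightarrow> nat) \<Rightarrow> (nat \<times> complex) list \<Rightarrow> complex^'n^'n" where
  "gamma_matrix pos bl =
     (\<chi> a b. if a = b then of_nat (concat (map (\<lambda>(k, lam). [1..<Suc k]) bl) ! pos a) else 0)"


section \<open>The spanning vector fields\<close>

definition vf_X :: "(complex \<Rightarrow> complex^'n) \<Rightarrow> 'n::finite vfield" where
  "vf_X \<phi> = (\<lambda>(t, x). (0, \<phi> t))"

definition vf_H :: "complex^'n^'n \<Rightarrow> 'n::finite vfield" where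
  "vf_H A = (\<lambda>(t, x). (0, A *v x))"

definition vf_T :: "'n::finite vfield" where
  "vf_T = (\<lambda>(t, x). (1, 0))"

definition vf_D :: "complex^'n^'n \<Rightarrow> 'n::finite vfield" where
  "vf_D G = (\<lambda>(t, x). (t, - 2 *s (G *v x)))"

end

theory Submission
  imports Defs
begin

text \<open>
  Write a vector field as \<open>\<xi>\<partial>\<^sub>t + \<eta>\<^sup>a\<partial>\<^sub>a\<close>. For the system with right-hand side \<open>J x\<close> the symmetry
  condition is polynomial of degree three in the velocity \<open>v\<close>, so its four homogeneous parts
  vanish separately (\<open>determining_equations\<close>). The cubic part says that the second \<open>x\<close>-derivatives
  of \<open>\<xi>\<close> vanish, and the quadratic part expresses the second \<open>x\<close>-derivatives of \<open>\<eta>\<close> by \<open>\<xi>\<^sub>t\<^sub>x\<close>.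
  Differentiating the linear part in \<open>x\<close> and inserting this gives, with the linear forms \<open>l = \<xi>\<^sub>x\<close>
  and \<open>\<alpha> = \<xi>\<^sub>t\<^sub>t\<^sub>x\<close>, \<open>2 \<alpha>(v) u + \<alpha>(u) v = l(J u) v + 2 l(v) J u\<close> for all vectors \<open>u\<close>, \<open>v\<close>
  (\<open>compatibility_identity\<close>). Contracting over \<open>v\<close> yields \<open>\<alpha>(u) = l(J u)\<close>, hence
  \<open>\<alpha>(v) u = l(v) J u\<close>; since \<open>J\<close> is not a multiple of the unit matrix, \<open>l = 0\<close>. Now \<open>\<xi>\<close> has
  vanishing \<open>x\<close>-derivatives, and differentiating the part of degree zero in \<open>x\<close> and \<open>t\<close> gives
  \<open>4 \<xi>\<^sub>t\<^sub>t J u = \<xi>\<^sub>t\<^sub>t\<^sub>t\<^sub>t u\<close>, so \<open>\<xi>\<^sub>t\<^sub>t = 0\<close> for the same reason. What remains is \<open>\<xi> = c t + d\<close>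
  and \<open>\<eta> = M x + f\<close>, where \<open>M J - J M = 2 c J\<close>, \<open>f\<close> has no \<open>x\<close>-derivatives and solves the system
  (\<open>symmetry_affine\<close>).

  Two points need analysis. The components are only assumed complex differentiable, but
  derivatives up to order four occur; Cauchy's formula on complex lines shows that directional
  derivatives are again holomorphic and commute. And \<open>f\<close> is only locally a function of \<open>t\<close>,
  because the slices of the domain at fixed \<open>t\<close> may be disconnected; it is therefore compared with
  the entire solution that has the same initial data at one point, and the difference vanishes by
  uniqueness and connectedness (\<open>flat_solution_extends\<close>). That such a solution lies in the span of
  the fundamental set is a dimension count.

  The rest is algebra. If \<open>M J - J M = 2 c J\<close> with \<open>c \<noteq> 0\<close>, then \<open>M J\<^sup>k - J\<^sup>k M = 2 k c J\<^sup>k\<close> for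
  all \<open>k\<close>; a bounded operator does not have arbitrarily large eigenvalues, so some \<open>J\<^sup>k\<close> vanishes
  (\<open>nilpotent_if_commutator\<close>). Hence \<open>c = 0\<close> for non-nilpotent \<open>J\<close>, and \<open>M\<close> lies in the commutant.
  For a nilpotent Jordan matrix the diagonal matrix \<open>\<gamma>\<close> satisfies \<open>J \<gamma> - \<gamma> J = J\<close>
  (\<open>gamma_commutator\<close>), so subtracting \<open>c\<close> times the field built from \<open>\<gamma>\<close> reduces to the case
  \<open>c = 0\<close>.
\<close>

no_notation fps_nth (infixl \<open>$\<close> 75)

section \<open>Holomorphic functions of several variables\<close>

definition holo_on :: "(complex \<times> (complex^'n::finite)) set \<Rightarrow> (complex \<times> (complex^'n) \<Rightarrow> complex)
  \<Rightarrow> bool" where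
  "holo_on \<Omega> f \<longleftrightarrow>
     (\<forall>p\<in>\<Omega>. \<exists>f'. (f has_derivative f') (at p) \<and> (\<forall>c h. f' (pointscale c h) = c * f' h))"

text \<open>
  The derivative is taken along the complex line through \<open>p\<close> in direction \<open>h\<close>, so that for
  holomorphic functions it is the value of the Frechet derivative at \<open>h\<close>, and results of one
  complex variable apply.
\<close>

definition dird :: "complex \<times> (complex^'n::finite) \<Rightarrow> (complex \<times> (complex^'n) \<Rightarrow> complex)
  \<Rightarrow> complex \<times> (complex^'n) \<Rightarrow> complex" where
  "dird h f p = deriv (\<lambda>z. f (p + pointscale z h)) 0"

lemma norm_vector_smult: "norm (c *s x) = norm c * norm (x :: complex^'n)"
  unfolding norm_vec_def L2_set_right_distrib[OF norm_ge_zero]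
  by (simp only: vector_smult_component norm_mult)

lemma norm_pointscale: "norm (pointscale c h) = norm c * norm h"
proof -
  have "norm (pointscale c h) = sqrt ((norm c)\<^sup>2 * ((norm (fst h))\<^sup>2 + (norm (snd h))\<^sup>2))"
    by (simp add: pointscale_def norm_prod_def norm_mult norm_vector_smult power_mult_distrib
      distrib_left)
  then show ?thesis
    by (simp add: real_sqrt_mult norm_prod_def[of h])
qed

lemma pointscale_add_left: "pointscale (a + b) h = pointscale a h + pointscale b h"
  by (simp add: pointscale_def distrib_right)

lemma pointscale_scaleR_left: "pointscale (r *\<^sub>R a) h = r *\<^sub>R pointscale a h"
  by (simp add: pointscale_def scaleR_prod_def vec_eq_iff)

lemma bounded_linear_pointscale_left: "bounded_linear (\<lambda>c. pointscale c h)"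
  by (rule bounded_linear_intro[OF pointscale_add_left pointscale_scaleR_left, where K = "norm h"])
    (simp only: norm_pointscale order_refl)

lemmas has_derivative_pointscale_left = bounded_linear.has_derivative[OF
  bounded_linear_pointscale_left]

lemma continuous_on_pointscale [continuous_intros]:
  "continuous_on S f \<Longrightarrow> continuous_on S (\<lambda>x. pointscale (f x) h)"
  by (rule bounded_linear.continuous_on[OF bounded_linear_pointscale_left])

lemma pointscale_simps [simp]:
  "pointscale 0 h = 0" "pointscale 1 h = h" "pointscale c 0 = 0"
  "pointscale a (pointscale b h) = pointscale (a * b) h"
  "fst (pointscale c h) = c * fst h" "snd (pointscale c h) = c *s snd h"
  by (auto simp: pointscale_def prod_eq_iff vec_eq_iff)

lemma line_has_field_derivative:
  assumes "(f has_derivative f') (at (p + pointscale z h))"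
    and "\<forall>c h. f' (pointscale c h) = c * f' h"
  shows "((\<lambda>z. f (p + pointscale z h)) has_field_derivative f' h) (at z)"
proof -
  have "((\<lambda>z. p + pointscale z h) has_derivative (\<lambda>z. pointscale z h)) (at z)"
    by (auto intro!: derivative_eq_intros has_derivative_pointscale_left)
  from has_derivative_compose[OF this assms(1)]
  have "((\<lambda>z. f (p + pointscale z h)) has_derivative (\<lambda>x. f' (pointscale x h))) (at z)" .
  moreover have "(\<lambda>x. f' (pointscale x h)) = (*) (f' h)"
    by (rule ext) (simp only: assms(2) mult.commute)
  ultimately show ?thesis
    by (simp add: has_field_derivative_def)
qed

lemma dird_eqI:
  assumes "(f has_derivative f') (at p)" and "\<forall>c h. f' (pointscale c h) = c * f' h"
  shows "dird h f p = f' h"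
proof -
  have "(f has_derivative f') (at (p + pointscale 0 h))"
    using assms(1) by simp
  from line_has_field_derivative[OF this assms(2)] show ?thesis
    unfolding dird_def by (rule DERIV_imp_deriv)
qed

lemma holo_on_has_derivative:
  assumes "holo_on \<Omega> f" "p \<in> \<Omega>"
  shows "(f has_derivative (\<lambda>h. dird h f p)) (at p)"
proof -
  obtain f' where f': "(f has_derivative f') (at p)" "\<forall>c h. f' (pointscale c h) = c * f' h"
    using assms unfolding holo_on_def by blast
  then have "f' = (\<lambda>h. dird h f p)"
    using dird_eqI[OF f'] by auto
  with f' show ?thesis by simp
qed

lemma holo_onI:
  assumes "\<And>p. p \<in> \<Omega> \<Longrightarrow> (f has_derivative f' p) (at p)"
    and "\<And>p c h. p \<in> \<Omega> \<Longrightarrow> f' p (pointscale c h) = c * f' p h"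
  shows "holo_on \<Omega> f"
  unfolding holo_on_def using assms by blast

lemma dird_pointscale:
  assumes "holo_on \<Omega> f" "p \<in> \<Omega>"
  shows "dird (pointscale c h) f p = c * dird h f p"
proof -
  obtain f' where f': "(f has_derivative f') (at p)" "\<forall>c h. f' (pointscale c h) = c * f' h"
    using assms unfolding holo_on_def by blast
  show ?thesis
    unfolding dird_eqI[OF f'] using f'(2) by (rule spec2)
qed

lemma linear_dird:
  assumes "holo_on \<Omega> f" "p \<in> \<Omega>"
  shows "linear (\<lambda>h. dird h f p)"
  by (rule has_derivative_linear[OF holo_on_has_derivative[OF assms]])

lemma dird_add_dir:
  assumes "holo_on \<Omega> f" "p \<in> \<Omega>"
  shows "dird (h + k) f p = dird h f p + dird k f p"
  using linear_add[OF linear_dird[OF assms], of h k] .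

lemma dird_sum_dir:
  assumes "holo_on \<Omega> f" "p \<in> \<Omega>"
  shows "dird (\<Sum>i\<in>I. h i) f p = (\<Sum>i\<in>I. dird (h i) f p)"
  using linear_sum[OF linear_dird[OF assms], of h I] .

lemma holo_on_line:
  assumes "holo_on \<Omega> f" "p + pointscale z h \<in> \<Omega>"
  shows "((\<lambda>z. f (p + pointscale z h)) has_field_derivative dird h f (p + pointscale z h)) (at z)"
  by (rule line_has_field_derivative[OF holo_on_has_derivative[OF assms]])
    (use dird_pointscale[OF assms] in blast)

lemma holo_on_continuous_on: "holo_on \<Omega> f \<Longrightarrow> continuous_on \<Omega> f"
  by (meson continuous_at_imp_continuous_on has_derivative_continuous holo_on_has_derivative)

section \<open>Cauchy's formula on complex lines\<close>

text \<open>
  The path \<^term>\<open>circlepath 0 r\<close> as an explicit function, for use in parameter integrals over the unit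
  interval.
\<close>

definition circ :: "real \<Rightarrow> real \<Rightarrow> complex" where
  "circ r t = of_real r * exp (2 * of_real pi * \<i> * of_real t)"

lemma norm_circ: "norm (circ r t) = \<bar>r\<bar>"
  by (simp add: circ_def norm_mult)

lemma circ_nonzero: "r \<noteq> 0 \<Longrightarrow> circ r t \<noteq> 0"
  by (simp add: circ_def)

lemma continuous_on_circ [continuous_intros]:
  "continuous_on S f \<Longrightarrow> continuous_on S (\<lambda>x. circ r (f x))"
  unfolding circ_def by (intro continuous_intros)

text \<open>
  In contrast to its definition as a limit, this expression of the derivative as an integral can
  be differentiated with respect to the base point.
\<close>

lemma dird_Cauchy:
  assumes f: "holo_on \<Omega> f" and r: "r > 0" and sub: "\<And>z. norm z \<le> r \<Longrightarrow> p + pointscale z h \<in> \<Omega>"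
  shows "dird h f p = integral (cbox 0 1) (\<lambda>t. f (p + pointscale (circ r t) h) / circ r t)"
proof -
  let ?g = "\<lambda>z. f (p + pointscale z h)"
  have der: "(?g has_field_derivative dird h f (p + pointscale z h)) (at z)" if "norm z \<le> r" for z
    using holo_on_line[OF f sub[OF that]] .
  have cont: "continuous_on (cball 0 r) ?g"
    by (intro continuous_at_imp_continuous_on ballI) (auto intro: DERIV_isCont[OF der])
  have hol: "?g holomorphic_on ball 0 r"
    unfolding holomorphic_on_def field_differentiable_def
    by (metis der has_field_derivative_at_within less_imp_le mem_ball_0)
  have "0 \<in> ball 0 r" using r by simp
  note C = Cauchy_derivative_integral_circlepath[OF cont hol this]
  have "dird h f p = 1 / (2 * of_real pi * \<i>) * contour_integral (circlepath 0 r)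
    (\<lambda>u. ?g u / (u - 0)^2)"
    unfolding dird_def by (rule DERIV_imp_deriv[OF C(2)])
  also have "contour_integral (circlepath 0 r) (\<lambda>u. ?g u / (u - 0)^2)
     = integral {0..1} (\<lambda>t. ?g (circ r t) / (circ r t)^2 * (2 * of_real pi * \<i> * circ r t))"
    unfolding contour_integral_integral vector_derivative_circlepath
    by (intro integral_cong) (simp add: circlepath circ_def algebra_simps)
  also have "\<dots> = (2 * of_real pi * \<i>) * integral {0..1} (\<lambda>t. ?g (circ r t) / circ r t)"
    unfolding integral_mult_right[symmetric]
    by (intro integral_cong) (use r in \<open>simp add: circ_nonzero field_simps power2_eq_square\<close>)
  finally show ?thesis by (simp add: cbox_interval)
qed

text \<open>
  The radius is uniform in the base point, so that Cauchy's formula holds with one and the same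
  circle on a whole neighbourhood.
\<close>

lemma complex_disc_nbhd:
  assumes "open \<Omega>" "p \<in> \<Omega>"
  obtains r e where "r > 0" "e > 0"
     "\<And>q z. q \<in> ball p e \<Longrightarrow> norm z \<le> r \<Longrightarrow> q + pointscale z h \<in> \<Omega>" "ball p e \<subseteq> \<Omega>"
proof -
  obtain d where d: "d > 0" "ball p d \<subseteq> \<Omega>" using assms openE by blast
  \<comment> \<open>The summand \<open>1\<close> covers the case \<open>h = 0\<close>.\<close>
  define r where "r = d / 2 / (norm h + 1)"
  have "norm h + 1 > 0" by (simp add: add_nonneg_pos)
  then have r: "r > 0" "r * norm h < d/2" using d
    by (auto simp: r_def field_simps add_nonneg_pos)
  show ?thesis
  proof (rule that[of r "d/2"])
    fix q z assume *: "q \<in> ball p (d/2)" "norm (z::complex) \<le> r"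
    have "dist p (q + pointscale z h) \<le> dist p q + norm (pointscale z h)"
      by (metis add_diff_cancel_left' dist_commute dist_norm dist_triangle)
    also have "\<dots> < d" using * r mult_right_mono[of "norm z" r "norm h"]
      by (simp add: norm_pointscale)
    finally show "q + pointscale z h \<in> \<Omega>" using d by auto
  qed (use d r in auto)
qed

text \<open>
  A parameter integral with continuous integrand is continuous. This continuity is what
  differentiation under the integral sign requires below.
\<close>

lemma continuous_on_dird:
  assumes f: "holo_on \<Omega> f" and \<Omega>: "open \<Omega>"
  shows "continuous_on \<Omega> (dird h f)"
proof (rule continuous_at_imp_continuous_on, rule ballI)
  fix p assume "p \<in> \<Omega>"
  then obtain r e where re: "r > 0" "e > 0"
     "\<And>q z. q \<in> ball p e \<Longrightarrow> norm z \<le> r \<Longrightarrow> q + pointscale z h \<in> \<Omega>" "ball p e \<subseteq> \<Omega>"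
    by (rule complex_disc_nbhd[OF \<Omega>]) blast
  have "continuous_on (ball p e \<times> cbox 0 1) (\<lambda>(q, t). f (q + pointscale (circ r t) h) / circ r t)"
    unfolding split_beta
    by (intro continuous_intros continuous_on_compose2[OF holo_on_continuous_on[OF f]] ballI)
      (use re in \<open>auto simp: norm_circ circ_nonzero\<close>)
  then have "continuous_on (ball p e)
    (\<lambda>q. integral (cbox 0 1) (\<lambda>t. f (q + pointscale (circ r t) h) / circ r t))"
    by (rule integral_continuous_on_param)
  then have "continuous_on (ball p e) (dird h f)"
    by (rule continuous_on_eq) (rule dird_Cauchy[OF f re(1,3), symmetric])
  then show "isCont (dird h f) p"
    using re by (simp add: continuous_on_eq_continuous_at)
qed

text \<open>
  Differentiation of Cauchy's formula under the integral sign. The integral on the right is not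
  yet recognised as \<open>dird h (dird k f) p\<close>: that would need Cauchy's formula for \<open>dird k f\<close>, whose
  holomorphy is a consequence of this lemma.
\<close>

lemma dird_has_derivative_Cauchy:
  assumes f: "holo_on \<Omega> f" and \<Omega>: "open \<Omega>" and "r > 0" "e > 0"
    and sub: "\<And>q z. q \<in> ball p e \<Longrightarrow> norm z \<le> r \<Longrightarrow> q + pointscale z h \<in> \<Omega>"
  shows "(dird h f has_derivative
    (\<lambda>k. integral (cbox 0 1) (\<lambda>t. dird k f (p + pointscale (circ r t) h) / circ r t))) (at p)"
proof -
  let ?g = "\<lambda>q t. f (q + pointscale (circ r t) h) / circ r t"
  define fx where "fx q t = Blinfun (\<lambda>k. dird k f (q + pointscale (circ r t) h) / circ r t)" for q t
  have in\<Omega>: "q + pointscale (circ r t) h \<in> \<Omega>" if "q \<in> ball p e" for q t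
    by (rule sub[OF that]) (use \<open>r > 0\<close> in \<open>simp add: norm_circ\<close>)
  have nz: "circ r t \<noteq> 0" for t
    using \<open>r > 0\<close> by (intro circ_nonzero) simp
  have der: "((\<lambda>q. ?g q t) has_derivative (\<lambda>k. dird k f (q + pointscale (circ r t) h) / circ r t))
    (at q)"
    if "q \<in> ball p e" for q t
  proof -
    have "((\<lambda>q. q + pointscale (circ r t) h) has_derivative (\<lambda>k. k)) (at q)"
      by (auto intro!: derivative_eq_intros)
    from has_derivative_compose[OF this holo_on_has_derivative[OF f in\<Omega>[OF that]]]
    have "((\<lambda>q. f (q + pointscale (circ r t) h)) has_derivative
      (\<lambda>k. dird k f (q + pointscale (circ r t) h))) (at q)" .
    then show ?thesis
      by (rule bounded_linear.has_derivative[OF bounded_linear_divide])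
  qed
  have fx: "blinfun_apply (fx q t) = (\<lambda>k. dird k f (q + pointscale (circ r t) h) / circ r t)"
    if "q \<in> ball p e" for q t
    unfolding fx_def
      by (rule bounded_linear_Blinfun_apply[OF has_derivative_bounded_linear[OF der[OF that]]])
  have cont: "continuous_on (ball p e \<times> cbox 0 1) (\<lambda>(q, t). u (q + pointscale (circ r t) h) / circ
    r t)"
    if "continuous_on \<Omega> u" for u :: "complex \<times> (complex^'a) \<Rightarrow> complex"
    unfolding split_beta
    by (intro continuous_intros continuous_on_compose2[OF that] ballI) (use in\<Omega> nz in auto)
  have int: "?g q integrable_on cbox 0 1" if "q \<in> ball p e" for q
    by (intro integrable_continuous continuous_intros nz ballI
        continuous_on_compose2[OF holo_on_continuous_on[OF f]]) (use in\<Omega>[OF that] in auto)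
  \<comment> \<open>In finite dimension, continuity of an operator-valued map may be tested on a basis.\<close>
  have cfx: "continuous_on (ball p e \<times> cbox 0 1) (\<lambda>(q, t). fx q t)"
  proof (rule continuous_on_blinfun_componentwise)
    fix i :: "complex \<times> (complex^'a)"
    have "continuous_on (ball p e \<times> cbox 0 1) (\<lambda>(q, t). dird i f (q + pointscale (circ r t) h) /
      circ r t)"
      by (rule cont[OF continuous_on_dird[OF f \<Omega>]])
    then show "continuous_on (ball p e \<times> cbox 0 1) (\<lambda>x. blinfun_apply (case x of (q, t) \<Rightarrow> fx q t)
      i)"
      by (rule continuous_on_eq) (auto simp: fx)
  qed
  have p: "p \<in> ball p e" using \<open>e > 0\<close> by simp
  have "((\<lambda>q. integral (cbox 0 1) (?g q)) has_derivative integral (cbox 0 1) (fx p))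
    (at p within ball p e)"
    by (rule leibniz_rule[OF _ int cfx p convex_ball]) (simp add: fx der has_derivative_at_withinI)
  then have "((\<lambda>q. integral (cbox 0 1) (?g q)) has_derivative integral (cbox 0 1) (fx p)) (at p)"
    using at_within_open[OF p open_ball] by simp
  moreover have "blinfun_apply (integral (cbox 0 1) (fx p)) =
      (\<lambda>k. integral (cbox 0 1) (\<lambda>t. dird k f (p + pointscale (circ r t) h) / circ r t))"
  proof
    fix k
    have "fx p integrable_on cbox 0 1"
      by (rule integrable_continuous, rule continuous_on_compose2[OF cfx, of _
        "\<lambda>t. (p, t)", unfolded prod.case])
        (use p in \<open>auto intro!: continuous_intros\<close>)
    then show "blinfun_apply (integral (cbox 0 1) (fx p)) k =
      integral (cbox 0 1) (\<lambda>t. dird k f (p + pointscale (circ r t) h) / circ r t)"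
      by (simp add: blinfun_apply_integral fx[OF p])
  qed
  ultimately have "((\<lambda>q. integral (cbox 0 1) (?g q)) has_derivative
     (\<lambda>k. integral (cbox 0 1) (\<lambda>t. dird k f (p + pointscale (circ r t) h) / circ r t))) (at p)"
    by (simp only:)
  then show ?thesis
    by (rule has_derivative_transform_within_open[OF _ open_ball p])
      (rule dird_Cauchy[OF f \<open>r > 0\<close> sub, symmetric])
qed

lemma holo_on_dird:
  assumes f: "holo_on \<Omega> f" and \<Omega>: "open \<Omega>"
  shows "holo_on \<Omega> (dird h f)"
  unfolding holo_on_def
proof
  fix p assume "p \<in> \<Omega>"
  then obtain r e where re: "r > 0" "e > 0"
     "\<And>q z. q \<in> ball p e \<Longrightarrow> norm z \<le> r \<Longrightarrow> q + pointscale z h \<in> \<Omega>" "ball p e \<subseteq> \<Omega>"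
    by (rule complex_disc_nbhd[OF \<Omega>]) blast
  have hom: "dird (pointscale c k) f (p + pointscale (circ r t) h) / circ r t =
      c * (dird k f (p + pointscale (circ r t) h) / circ r t)" for c k t
    by (subst dird_pointscale[OF f re(3)]) (use re in \<open>auto simp: norm_circ\<close>)
  show "\<exists>f'. (dird h f has_derivative f') (at p) \<and> (\<forall>c k. f' (pointscale c k) = c * f' k)"
  proof (intro exI conjI allI)
    show "(dird h f has_derivative
      (\<lambda>k. integral (cbox 0 1) (\<lambda>t. dird k f (p + pointscale (circ r t) h) / circ r t))) (at p)"
      by (rule dird_has_derivative_Cauchy[OF f \<Omega> re(1-3)])
    show "integral (cbox 0 1) (\<lambda>t. dird (pointscale c k) f (p + pointscale (circ r t) h) / circ r
      t) =
        c * integral (cbox 0 1) (\<lambda>t. dird k f (p + pointscale (circ r t) h) / circ r t)" for c k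
      unfolding hom by (rule integral_mult_right)
  qed
qed

text \<open>
  With both derivatives known to be holomorphic, the integral above is Cauchy's formula for
  \<open>dird k f\<close>.
\<close>

lemma dird_commute:
  assumes f: "holo_on \<Omega> f" and \<Omega>: "open \<Omega>" and p: "p \<in> \<Omega>"
  shows "dird k (dird h f) p = dird h (dird k f) p"
proof -
  obtain r e where re: "r > 0" "e > 0"
     "\<And>q z. q \<in> ball p e \<Longrightarrow> norm z \<le> r \<Longrightarrow> q + pointscale z h \<in> \<Omega>" "ball p e \<subseteq> \<Omega>"
    by (rule complex_disc_nbhd[OF \<Omega> p]) blast
  have "(\<lambda>k. dird k (dird h f) p) =
      (\<lambda>k. integral (cbox 0 1) (\<lambda>t. dird k f (p + pointscale (circ r t) h) / circ r t))"
    by (rule has_derivative_unique[OF holo_on_has_derivative[OF holo_on_dird[OF f \<Omega>] p]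
          dird_has_derivative_Cauchy[OF f \<Omega> re(1-3)]])
  also have "\<dots> = (\<lambda>k. dird h (dird k f) p)"
    by (rule ext, rule dird_Cauchy[OF holo_on_dird[OF f \<Omega>] re(1) re(3), symmetric]) (use re in auto)
  finally show ?thesis by (rule fun_cong)
qed

section \<open>Calculus of directional derivatives\<close>

lemma holo_on_cong:
  assumes "open \<Omega>" "\<And>p. p \<in> \<Omega> \<Longrightarrow> f p = g p" "holo_on \<Omega> f"
  shows "holo_on \<Omega> g"
proof (rule holo_onI)
  fix p assume p: "p \<in> \<Omega>"
  show "(g has_derivative (\<lambda>h. dird h f p)) (at p)"
    by (rule has_derivative_transform_within_open[OF holo_on_has_derivative[OF assms(3) p]
      assms(1) p])
      (rule assms(2))
qed (rule dird_pointscale[OF assms(3)])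

lemma dird_cong:
  assumes "open \<Omega>" "\<And>p. p \<in> \<Omega> \<Longrightarrow> f p = g p" "p \<in> \<Omega>"
  shows "dird h f p = dird h g p"
proof -
  have "continuous_on UNIV (\<lambda>z. p + pointscale z h)"
    by (intro continuous_intros)
  then have "open ((\<lambda>z. p + pointscale z h) -` \<Omega>)"
    using assms(1) by (simp add: continuous_on_open_vimage)
  then have "\<forall>\<^sub>F z in nhds 0. z \<in> (\<lambda>z. p + pointscale z h) -` \<Omega>"
    by (rule eventually_nhds_in_open) (use assms(3) in simp)
  then show ?thesis
    unfolding dird_def
    by (intro deriv_cong_ev refl) (auto elim!: eventually_mono simp: assms(2))
qed

lemma
  shows holo_on_const: "holo_on \<Omega> (\<lambda>p. c)"
    and dird_const: "dird h (\<lambda>p. c) p = 0"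
  by (rule holo_onI[where f' = "\<lambda>_ _. 0"]) (auto simp: dird_def)

lemma
  assumes f: "holo_on \<Omega> f" and g: "holo_on \<Omega> g"
  shows holo_on_add: "holo_on \<Omega> (\<lambda>p. f p + g p)"
    and dird_add: "p \<in> \<Omega> \<Longrightarrow> dird h (\<lambda>p. f p + g p) p = dird h f p + dird h g p"
proof -
  note D = has_derivative_add[OF holo_on_has_derivative[OF f] holo_on_has_derivative[OF g]]
  show "holo_on \<Omega> (\<lambda>p. f p + g p)"
    by (rule holo_onI[OF D]) (simp_all add: dird_pointscale[OF f] dird_pointscale[OF g]
      distrib_left)
  show "dird h (\<lambda>p. f p + g p) p = dird h f p + dird h g p" if "p \<in> \<Omega>"
    by (rule dird_eqI[OF D]) (simp_all only: that dird_pointscale[OF f] dird_pointscale[OF g]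
      distrib_left simp_thms)
qed

lemma
  assumes f: "holo_on \<Omega> f" and g: "holo_on \<Omega> g"
  shows holo_on_diff: "holo_on \<Omega> (\<lambda>p. f p - g p)"
    and dird_diff: "p \<in> \<Omega> \<Longrightarrow> dird h (\<lambda>p. f p - g p) p = dird h f p - dird h g p"
proof -
  note D = has_derivative_diff[OF holo_on_has_derivative[OF f] holo_on_has_derivative[OF g]]
  show "holo_on \<Omega> (\<lambda>p. f p - g p)"
    by (rule holo_onI[OF D]) (simp_all add: dird_pointscale[OF f] dird_pointscale[OF g]
      right_diff_distrib)
  show "dird h (\<lambda>p. f p - g p) p = dird h f p - dird h g p" if "p \<in> \<Omega>"
    by (rule dird_eqI[OF D]) (simp_all only: that dird_pointscale[OF f] dird_pointscale[OF g]
      right_diff_distrib simp_thms)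
qed

lemma
  assumes f: "holo_on \<Omega> f" and g: "holo_on \<Omega> g"
  shows holo_on_mult: "holo_on \<Omega> (\<lambda>p. f p * g p)"
    and dird_mult: "p \<in> \<Omega> \<Longrightarrow> dird h (\<lambda>p. f p * g p) p = f p * dird h g p + dird h f p * g p"
proof -
  note D = has_derivative_mult[OF holo_on_has_derivative[OF f] holo_on_has_derivative[OF g]]
  show "holo_on \<Omega> (\<lambda>p. f p * g p)"
    by (rule holo_onI[OF D]) (simp_all add: dird_pointscale[OF f] dird_pointscale[OF g]
      algebra_simps)
  show "dird h (\<lambda>p. f p * g p) p = f p * dird h g p + dird h f p * g p" if "p \<in> \<Omega>"
    by (rule dird_eqI[OF D]) (simp_all add: that dird_pointscale[OF f] dird_pointscale[OF g]
      algebra_simps)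
qed

lemma
  assumes f: "holo_on \<Omega> f"
  shows holo_on_cmult: "holo_on \<Omega> (\<lambda>p. c * f p)"
    and dird_cmult: "p \<in> \<Omega> \<Longrightarrow> dird h (\<lambda>p. c * f p) p = c * dird h f p"
  using holo_on_mult[OF holo_on_const f] dird_mult[OF holo_on_const f] by (simp_all add: dird_const)

lemma dird_divide:
  assumes f: "holo_on \<Omega> f" and p: "p \<in> \<Omega>"
  shows "dird h (\<lambda>p. f p / c) p = dird h f p / c"
proof -
  have "(\<lambda>p. f p / c) = (\<lambda>p. inverse c * f p)"
    by (simp add: divide_inverse mult.commute)
  then show ?thesis
    by (simp only: dird_cmult[OF f p] divide_inverse mult.commute)
qed

lemma holo_on_sum:
  assumes "\<And>i. i \<in> I \<Longrightarrow> holo_on \<Omega> (f i)"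
  shows "holo_on \<Omega> (\<lambda>p. \<Sum>i\<in>I. f i p)"
  using assms by (induction I rule: infinite_finite_induct) (auto intro: holo_on_const holo_on_add)

lemma dird_sum:
  assumes "\<And>i. i \<in> I \<Longrightarrow> holo_on \<Omega> (f i)" "p \<in> \<Omega>"
  shows "dird h (\<lambda>p. \<Sum>i\<in>I. f i p) p = (\<Sum>i\<in>I. dird h (f i) p)"
  using assms
proof (induction I rule: infinite_finite_induct)
  case (insert i I)
  have "dird h (\<lambda>p. f i p + (\<Sum>i\<in>I. f i p)) p = dird h (f i) p + dird h (\<lambda>p. \<Sum>i\<in>I. f i p) p"
    using insert.prems by (intro dird_add holo_on_sum) auto
  with insert show ?case by simp
qed (simp_all add: dird_const)

lemma
  shows holo_on_fst: "holo_on \<Omega> fst" and dird_fst: "dird h fst p = fst h"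
proof -
  have D: "(fst has_derivative fst) (at p)" for p :: "complex \<times> (complex^'n)"
    by (rule bounded_linear_imp_has_derivative[OF bounded_linear_fst])
  show "holo_on \<Omega> fst" by (rule holo_onI[OF D]) simp
  show "dird h fst p = fst h" by (rule dird_eqI[OF D]) simp
qed

lemma
  shows holo_on_snd_nth: "holo_on \<Omega> (\<lambda>p. snd p $ a)" and dird_snd_nth: "dird h (\<lambda>p. snd p $ a) p
    = snd h $ a"
proof -
  have D: "((\<lambda>p. snd p $ a) has_derivative (\<lambda>p. snd p $ a)) (at p)"
    for p :: "complex \<times> (complex^'a)"
    by (intro bounded_linear_imp_has_derivative bounded_linear_compose[OF bounded_linear_vec_nth
      bounded_linear_snd])
  show "holo_on \<Omega> (\<lambda>p. snd p $ a)" by (rule holo_onI[OF D]) simp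
  show "dird h (\<lambda>p. snd p $ a) p = snd h $ a" by (rule dird_eqI[OF D]) simp
qed

lemma
  assumes f: "f holomorphic_on UNIV"
  shows holo_on_compose_fst: "holo_on \<Omega> (\<lambda>p. f (fst p))"
    and dird_compose_fst: "dird h (\<lambda>p. f (fst p)) p = fst h * deriv f (fst p)"
proof -
  have D: "((\<lambda>p. f (fst p)) has_derivative (\<lambda>h. deriv f (fst p) * fst h)) (at p)"
    for p :: "complex \<times> (complex^'n)"
  proof -
    have "(f has_derivative (*) (deriv f (fst p))) (at (fst p))"
      using f holomorphic_derivI[OF f open_UNIV] by (simp add: has_field_derivative_def)
    from has_derivative_compose[OF bounded_linear_imp_has_derivative[OF bounded_linear_fst] this]
    show ?thesis .
  qed
  show "holo_on \<Omega> (\<lambda>p. f (fst p))" by (rule holo_onI[OF D]) simp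
  show "dird h (\<lambda>p. f (fst p)) p = fst h * deriv f (fst p)" by (subst dird_eqI[OF D]) simp_all
qed

lemma holo_on_constant:
  assumes "holo_on \<Omega> f" "open \<Omega>" "connected \<Omega>" "\<And>p h. p \<in> \<Omega> \<Longrightarrow> dird h f p = 0"
  shows "\<exists>c. \<forall>p\<in>\<Omega>. f p = c"
proof -
  have D: "(f has_derivative (\<lambda>h. 0)) (at p)" if "p \<in> \<Omega>" for p
    using holo_on_has_derivative[OF assms(1) that] assms(4)[OF that] by simp
  have "f p = f q" if "p \<in> \<Omega>" "q \<in> \<Omega>" for p q
    using has_derivative_zero_unique_connected[OF assms(2,3) D that] .
  then show ?thesis by metis
qed

section \<open>The symmetry condition as a polynomial in the velocity\<close>

abbreviation dt :: "(complex \<times> (complex^'n::finite) \<Rightarrow> complex) \<Rightarrow> complex \<times> (complex^'n) \<Rightarrow> complex"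
  where
  "dt \<equiv> dird (1, 0)"

abbreviation dx :: "complex^'n::finite \<Rightarrow> (complex \<times> (complex^'n) \<Rightarrow> complex)
  \<Rightarrow> complex \<times> (complex^'n) \<Rightarrow> complex" where
  "dx u \<equiv> dird (0, u)"

lemma dx_add:
  assumes "holo_on \<Omega> f" "p \<in> \<Omega>"
  shows "dx (u + v) f p = dx u f p + dx v f p"
  using dird_add_dir[OF assms, of "(0, u)" "(0, v)"] by simp

lemma dx_smult:
  assumes "holo_on \<Omega> f" "p \<in> \<Omega>"
  shows "dx (c *s u) f p = c * dx u f p"
  using dird_pointscale[OF assms, of c "(0, u)"] by (simp add: pointscale_def)

lemma dx_sum_axis:
  assumes "holo_on \<Omega> f" "p \<in> \<Omega>"
  shows "(\<Sum>a\<in>UNIV. v $ a * dx (axis a 1) f p) = dx v f p"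
proof -
  have "(0, v) = (\<Sum>a\<in>UNIV. (0, v $ a *s axis a 1))"
    by (simp add: prod_eq_iff fst_sum snd_sum basis_expansion)
  then have "dx v f p = (\<Sum>a\<in>UNIV. dird (0, v $ a *s axis a 1) f p)"
    using dird_sum_dir[OF assms] by metis
  then show ?thesis by (simp add: dx_smult[OF assms])
qed

lemma dird_split:
  assumes "holo_on \<Omega> f" "p \<in> \<Omega>"
  shows "dird h f p = fst h * dt f p + dx (snd h) f p"
proof -
  have "h = pointscale (fst h) (1, 0) + (0, snd h)" by (simp add: pointscale_def prod_eq_iff)
  then show ?thesis by (metis dird_add_dir[OF assms] dird_pointscale[OF assms])
qed

lemma axis_line: "x + z *s axis a 1 = x + axis a (z::complex)"
  by (auto simp: vec_eq_iff axis_def)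

lemma pd_t_eq_dt:
  assumes "open \<Omega>" "\<And>s y. (s, y) \<in> \<Omega> \<Longrightarrow> F s y v = g (s, y)" "(t, x) \<in> \<Omega>"
  shows "pd_t F t x v = dt g (t, x)"
proof -
  have "pd_t F t x v = dt (\<lambda>p. F (fst p) (snd p) v) (t, x)"
    unfolding pd_t_def dird_def deriv_shift_0[of "\<lambda>s. F s x v"]
    by (simp add: o_def pointscale_def add.commute)
  also have "\<dots> = dt g (t, x)"
    by (rule dird_cong[OF assms(1) _ assms(3)]) (simp add: assms(2))
  finally show ?thesis .
qed

lemma pd_x_eq_dx:
  assumes "open \<Omega>" "\<And>s y. (s, y) \<in> \<Omega> \<Longrightarrow> F s y v = g (s, y)" "(t, x) \<in> \<Omega>"
  shows "pd_x a F t x v = dx (axis a 1) g (t, x)"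
proof -
  have "pd_x a F t x v = dx (axis a 1) (\<lambda>p. F (fst p) (snd p) v) (t, x)"
    unfolding pd_x_def dird_def by (simp add: pointscale_def axis_line)
  also have "\<dots> = dx (axis a 1) g (t, x)"
    by (rule dird_cong[OF assms(1) _ assms(3)]) (simp add: assms(2))
  finally show ?thesis .
qed

lemma total_deriv_eq:
  assumes "open \<Omega>" "holo_on \<Omega> g" "\<And>s y. (s, y) \<in> \<Omega> \<Longrightarrow> F s y v = g (s, y)" "(t, x) \<in> \<Omega>"
  shows "total_deriv w F t x v =
    dt g (t, x) + dx v g (t, x) + (\<Sum>a\<in>UNIV. w $ a * pd_v a F t x v)"
proof -
  have "pd_t F t x v = dt g (t, x)" "\<And>a. pd_x a F t x v = dx (axis a 1) g (t, x)"
    by (rule pd_t_eq_dt pd_x_eq_dx, (fact assms)+)+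
  then show ?thesis
    unfolding total_deriv_def by (simp only: dx_sum_axis[OF assms(2,4)])
qed

definition tcomp :: "'n::finite vfield \<Rightarrow> complex \<times> (complex^'n) \<Rightarrow> complex" where
  "tcomp Q p = fst (Q p)"

definition xcomp :: "'n::finite vfield \<Rightarrow> 'n \<Rightarrow> complex \<times> (complex^'n) \<Rightarrow> complex" where
  "xcomp Q b p = snd (Q p) $ b"

lemma pd_v_no_v: "pd_v a (\<lambda>t x v. f t x) t x v = 0"
  by (simp add: pd_v_def)

lemma total_deriv_base:
  assumes "open \<Omega>" "holo_on \<Omega> g" "(t, x) \<in> \<Omega>"
  shows "total_deriv w (\<lambda>t x v. g (t, x)) t x v = dt g (t, x) + dx v g (t, x)"
  by (simp add: total_deriv_eq[OF assms(1,2) refl assms(3)] pd_v_no_v)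

text \<open>
  The first prolongation in terms of directional derivatives; the second derivative of \<open>x\<close>, on
  which \<^const>\<open>eta1\<close> formally depends, has dropped out.
\<close>

definition prolong1 :: "'n::finite vfield \<Rightarrow> 'n \<Rightarrow> complex^'n \<Rightarrow> complex \<times> (complex^'n) \<Rightarrow> complex"
  where
  "prolong1 Q b v p = dt (xcomp Q b) p + dx v (xcomp Q b) p
    - v $ b * (dt (tcomp Q) p + dx v (tcomp Q) p)"

context
  fixes \<Omega> :: "(complex \<times> (complex^'n::finite)) set" and Q :: "'n vfield"
  assumes \<Omega>: "open \<Omega>" and T: "holo_on \<Omega> (tcomp Q)" and X: "\<And>b. holo_on \<Omega> (xcomp Q b)"
begin

lemma xi_eq: "xi Q = (\<lambda>t x v. tcomp Q (t, x))"
  by (simp add: xi_def tcomp_def fun_eq_iff)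

lemma eta_eq: "eta Q b = (\<lambda>t x v. xcomp Q b (t, x))"
  by (simp add: eta_def xcomp_def fun_eq_iff)

lemma eta1_eq: "(t, x) \<in> \<Omega> \<Longrightarrow> eta1 w Q b t x v = prolong1 Q b v (t, x)"
  unfolding eta1_def xi_eq eta_eq prolong1_def
  by (simp add: total_deriv_base[OF \<Omega> T] total_deriv_base[OF \<Omega> X])

lemma holo_on_prolong1: "holo_on \<Omega> (prolong1 Q b v)"
  unfolding prolong1_def
  by (intro holo_on_add holo_on_diff holo_on_cmult holo_on_dird T X \<Omega>)

lemma dird_prolong1:
  assumes "p \<in> \<Omega>"
  shows "dird h (prolong1 Q b v) p = dird h (dt (xcomp Q b)) p + dird h (dx v (xcomp Q b)) p
    - v $ b * (dird h (dt (tcomp Q)) p + dird h (dx v (tcomp Q)) p)"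
  unfolding prolong1_def
  by (simp add: dird_diff[of \<Omega>] dird_add[of \<Omega>] dird_cmult[of \<Omega>]
      holo_on_add holo_on_diff holo_on_cmult holo_on_dird T X \<Omega> assms)

lemma pd_v_eta1:
  assumes p: "(t, x) \<in> \<Omega>"
  shows "pd_v a (eta1 w Q b) t x v = dx (axis a 1) (xcomp Q b) (t, x)
    - axis a 1 $ b * (dt (tcomp Q) (t, x) + dx v (tcomp Q) (t, x))
    - v $ b * dx (axis a 1) (tcomp Q) (t, x)"
proof -
  have lin: "dx (v + axis a z) f (t, x) = dx v f (t, x) + z * dx (axis a 1) f (t, x)"
    if "holo_on \<Omega> f" for f z
    using dx_add[OF that p, of v "z *s axis a 1"] dx_smult[OF that p] by (simp add: axis_line)
  have ax: "axis a z $ b = z * axis a 1 $ b" for z :: complex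
    by (simp add: axis_def)
  show ?thesis
    unfolding pd_v_def eta1_eq[OF p] prolong1_def lin[OF T] lin[OF X] vector_add_component
    by (subst ax) (rule DERIV_imp_deriv, auto intro!: derivative_eq_intros simp: algebra_simps)
qed

text \<open>
  The contraction with \<open>v\<close> of the partial derivatives with respect to \<open>x\<close> is the directional
  derivative along \<open>v\<close>, so the symmetry condition can be written without indices of summation. In
  this form it is evidently polynomial in \<open>v\<close>.
\<close>

lemma lie_symmetry_linear_iff:
  "lie_symmetry \<Omega> (linear_rhs J) Q \<longleftrightarrow>
    (\<forall>p\<in>\<Omega>. \<forall>v b.
      dt (dt (xcomp Q b)) p + 2 * dt (dx v (xcomp Q b)) p + dx v (dx v (xcomp Q b)) p
      - v $ b * (dt (dt (tcomp Q)) p + 2 * dt (dx v (tcomp Q)) p + dx v (dx v (tcomp Q)) p)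
      + dx (J *v snd p) (xcomp Q b) p
      - 2 * (J *v snd p) $ b * (dt (tcomp Q) p + dx v (tcomp Q) p)
      - v $ b * dx (J *v snd p) (tcomp Q) p
     = (\<Sum>a\<in>UNIV. J $ b $ a * xcomp Q a p))"
proof -
  have rhs: "pd_t (\<lambda>t x v. linear_rhs J t x v $ b) t x v = 0"
    "pd_v a (\<lambda>t x v. linear_rhs J t x v $ b) t x v = 0"
    "pd_x a (\<lambda>t x v. linear_rhs J t x v $ b) t x v = J $ b $ a" for a b t x v
  proof -
    have "(J *v axis a z) $ b = J $ b $ a * z" for z
      by (simp add: matrix_vector_mult_def axis_def if_distrib[of "(*) _"] cong: if_cong)
    then have "(J *v (x + axis a z)) $ b = (J *v x) $ b + J $ b $ a * z" for z
      by (simp add: matrix_vector_right_distrib)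
    then show "pd_x a (\<lambda>t x v. linear_rhs J t x v $ b) t x v = J $ b $ a"
      unfolding pd_x_def linear_rhs_def
      by (simp only:) (rule DERIV_imp_deriv, auto intro!: derivative_eq_intros)
  qed (simp_all add: pd_t_def pd_v_def linear_rhs_def)
  have lhs: "eta2 w Q b t x v =
      dt (dt (xcomp Q b)) (t,x) + 2 * dt (dx v (xcomp Q b)) (t,x) + dx v (dx v (xcomp Q b)) (t,x)
      - v $ b * (dt (dt (tcomp Q)) (t,x) + 2 * dt (dx v (tcomp Q)) (t,x) + dx v (dx v (tcomp Q))
        (t,x))
      + dx w (xcomp Q b) (t,x)
      - 2 * w $ b * (dt (tcomp Q) (t,x) + dx v (tcomp Q) (t,x))
      - v $ b * dx w (tcomp Q) (t,x)" if p: "(t, x) \<in> \<Omega>" for w b t x v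
  proof -
    let ?\<xi> = "dt (tcomp Q) (t,x) + dx v (tcomp Q) (t,x)"
    have 1: "total_deriv w (xi Q) t x v = ?\<xi>"
      unfolding xi_eq by (rule total_deriv_base[OF \<Omega> T p])
    have 2: "total_deriv w (eta1 w Q b) t x v =
      dt (prolong1 Q b v) (t, x) + dx v (prolong1 Q b v) (t, x) +
        (\<Sum>a\<in>UNIV. w $ a * pd_v a (eta1 w Q b) t x v)"
      by (rule total_deriv_eq[OF \<Omega> holo_on_prolong1 _ p]) (rule eta1_eq)
    have 3: "(\<Sum>a\<in>UNIV. w $ a * pd_v a (eta1 w Q b) t x v)
       = dx w (xcomp Q b) (t, x) - w $ b * ?\<xi> - v $ b * dx w (tcomp Q) (t, x)"
    proof -
      have "(\<Sum>a\<in>UNIV. w $ a * pd_v a (eta1 w Q b) t x v) =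
        (\<Sum>a\<in>UNIV. w $ a * dx (axis a 1) (xcomp Q b) (t, x))
        - (\<Sum>a\<in>UNIV. w $ a * axis a 1 $ b) * ?\<xi>
        - v $ b * (\<Sum>a\<in>UNIV. w $ a * dx (axis a 1) (tcomp Q) (t, x))"
        unfolding pd_v_eta1[OF p]
          by (simp add: algebra_simps sum.distrib sum_subtractf sum_distrib_left sum_distrib_right)
      also have "(\<Sum>a\<in>UNIV. w $ a * axis a 1 $ b) = w $ b"
        by (simp add: axis_def if_distrib cong: if_cong)
      finally show ?thesis unfolding dx_sum_axis[OF X p] dx_sum_axis[OF T p] .
    qed
    show ?thesis
      unfolding eta2_def 1 2 3 dird_prolong1[OF p]
        dird_commute[OF X \<Omega> p, of "(0, v)" "(1, 0)"] dird_commute[OF T \<Omega> p, of "(0, v)" "(1, 0)"]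
      by (simp add: algebra_simps)
  qed
  show ?thesis
    unfolding lie_symmetry_def rhs
    by (auto simp: lhs linear_rhs_def eta_eq mult.commute[of "J $ _ $ _"])
qed

end

section \<open>Solving the determining equations\<close>

lemma cubic_coeffs_zero:
  fixes a0 a1 a2 a3 :: complex
  assumes "\<And>z. a0 + z * a1 + z * z * a2 + z * z * z * a3 = 0"
  shows "a0 = 0" "a1 = 0" "a2 = 0" "a3 = 0"
proof -
  show 0: "a0 = 0" using assms[of 0] by simp
  have 1: "a1 + a2 + a3 = 0" "- a1 + a2 - a3 = 0" "2 * a1 + 4 * a2 + 8 * a3 = 0"
    using assms[of 1] assms[of "-1"] assms[of 2] 0 by simp_all
  have "2 * a2 = (a1 + a2 + a3) + (- a1 + a2 - a3)" by simp
  then show 2: "a2 = 0" by (simp only: 1) simp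
  have "6 * a3 = (2 * a1 + 4 * a2 + 8 * a3) - 2 * (a1 + a2 + a3)" using 2 by simp
  then show 3: "a3 = 0" by (simp only: 1) simp
  show "a1 = 0" using 1 2 3 by simp
qed

text \<open>
  Both obstructions in the classification have this form: a nonzero value of \<open>\<xi>\<^sub>x\<close> or of \<open>\<xi>\<^sub>t\<^sub>t\<close>
  would make every vector an eigenvector of \<open>J\<close> with the same eigenvalue.
\<close>

lemma scalar_matrixI:
  assumes "\<And>u b. (J *v u) $ b * c = d * u $ b" and "c \<noteq> 0"
  shows "J \<in> cmat.span {Finite_Cartesian_Product.mat 1}"
proof -
  have "J $ b $ a = d / c * (Finite_Cartesian_Product.mat 1) $ b $ a" for a b
    using assms(1)[of "axis a 1" b] assms(2)
    by (auto simp: matrix_vector_mul_component inner_axis Finite_Cartesian_Product.mat_def axis_def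
        matrix_vector_mult_def field_simps if_distrib cong: if_cong)
  then have "J = matscale (d / c) (Finite_Cartesian_Product.mat 1)"
    by (simp add: vec_eq_iff matscale_def)
  then show ?thesis by (auto simp: cmat.span_singleton)
qed

lemma
  shows holo_on_mult_vec_nth: "holo_on \<Omega> (\<lambda>p. (J *v snd p) $ b)"
    and dird_mult_vec_nth: "dird h (\<lambda>p. (J *v snd p) $ b) p = (J *v snd h) $ b"
proof -
  have eq: "(\<lambda>p. (J *v snd p) $ b) = (\<lambda>p. \<Sum>a\<in>UNIV. J $ b $ a * snd p $ a)"
    by (simp add: matrix_vector_mult_def)
  show "holo_on \<Omega> (\<lambda>p. (J *v snd p) $ b)"
    unfolding eq by (intro holo_on_sum holo_on_cmult holo_on_snd_nth)
  show "dird h (\<lambda>p. (J *v snd p) $ b) p = (J *v snd h) $ b"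
    unfolding eq using dird_sum[of UNIV UNIV "\<lambda>a p. J $ b $ a * snd p $ a" p h]
    by (simp add: holo_on_cmult holo_on_snd_nth dird_cmult[OF holo_on_snd_nth UNIV_I] dird_snd_nth
      matrix_vector_mult_def)
qed

text \<open>
  Here the direction of differentiation depends on the point, which contributes the extra term
  \<open>dx (J *v snd h) f p\<close>.
\<close>

lemma
  assumes \<Omega>: "open \<Omega>" and f: "holo_on \<Omega> f"
  shows holo_on_dx_J: "holo_on \<Omega> (\<lambda>p. dx (J *v snd p) f p)"
    and dird_dx_J: "p \<in> \<Omega> \<Longrightarrow> dird h (\<lambda>p. dx (J *v snd p) f p) p =
      dx (J *v snd h) f p + dx (J *v snd p) (dird h f) p"
proof -
  have eq: "(\<Sum>a\<in>UNIV. (J *v snd p) $ a * dx (axis a 1) f p) = dx (J *v snd p) f p" if "p \<in> \<Omega>" for p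
    by (rule dx_sum_axis[OF f that])
  have hol: "holo_on \<Omega> (\<lambda>p. (J *v snd p) $ a * dx (axis a 1) f p)" for a
    by (intro holo_on_mult holo_on_mult_vec_nth holo_on_dird f \<Omega>)
  then have "holo_on \<Omega> (\<lambda>p. \<Sum>a\<in>UNIV. (J *v snd p) $ a * dx (axis a 1) f p)"
    by (intro holo_on_sum)
  from holo_on_cong[OF \<Omega> eq this] show "holo_on \<Omega> (\<lambda>p. dx (J *v snd p) f p)" .
  assume p: "p \<in> \<Omega>"
  have "dird h (\<lambda>p. dx (J *v snd p) f p) p
    = dird h (\<lambda>p. \<Sum>a\<in>UNIV. (J *v snd p) $ a * dx (axis a 1) f p) p"
    by (rule dird_cong[OF \<Omega> eq[symmetric] p])
  also have "\<dots> = (\<Sum>a\<in>UNIV. dird h (\<lambda>p. (J *v snd p) $ a * dx (axis a 1) f p) p)"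
    by (rule dird_sum[OF hol p])
  also have "\<dots> = (\<Sum>a\<in>UNIV. (J *v snd h) $ a * dx (axis a 1) f p)
    + (\<Sum>a\<in>UNIV. (J *v snd p) $ a * dx (axis a 1) (dird h f) p)"
    by (simp add: dird_mult[OF holo_on_mult_vec_nth holo_on_dird[OF f \<Omega>] p] dird_mult_vec_nth
        sum.distrib dird_commute[OF f \<Omega> p] add.commute)
  finally show "dird h (\<lambda>p. dx (J *v snd p) f p) p =
      dx (J *v snd h) f p + dx (J *v snd p) (dird h f) p"
    unfolding dx_sum_axis[OF f p] dx_sum_axis[OF holo_on_dird[OF f \<Omega>] p] .
qed

text \<open>
  The components of a symmetry field as unknown functions; \<open>\<tau>\<close> stands for the coefficient \<open>\<xi>\<close> of
  \<open>\<partial>\<^sub>t\<close>.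
\<close>

locale symmetry_pde =
  fixes \<Omega> :: "(complex \<times> (complex^'n::finite)) set"
    and \<tau> :: "complex \<times> (complex^'n) \<Rightarrow> complex" and \<eta> :: "'n \<Rightarrow> complex \<times> (complex^'n) \<Rightarrow> complex"
    and J :: "complex^'n^'n"
  assumes \<Omega>: "open \<Omega>" and T: "holo_on \<Omega> \<tau>" and X: "\<And>b. holo_on \<Omega> (\<eta> b)"
    and sym: "\<And>p v b. p \<in> \<Omega> \<Longrightarrow>
      dt (dt (\<eta> b)) p + 2 * dt (dx v (\<eta> b)) p + dx v (dx v (\<eta> b)) p
      - v $ b * (dt (dt \<tau>) p + 2 * dt (dx v \<tau>) p + dx v (dx v \<tau>) p)
      + dx (J *v snd p) (\<eta> b) p
      - 2 * (J *v snd p) $ b * (dt \<tau> p + dx v \<tau> p)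
      - v $ b * dx (J *v snd p) \<tau> p
     = (\<Sum>a\<in>UNIV. J $ b $ a * \<eta> a p)"
    and nonscalar: "J \<notin> cmat.span {Finite_Cartesian_Product.mat 1}"
begin

lemma dird_dx_smult: "holo_on \<Omega> f \<Longrightarrow> p \<in> \<Omega> \<Longrightarrow> dird h (dx (c *s u) f) p = c * dird h (dx u f) p"
  by (subst dird_cmult[OF holo_on_dird[OF _ \<Omega>], symmetric]) (auto intro!: dird_cong[OF \<Omega>] dx_smult)

lemma dird_dx_add: "holo_on \<Omega> f \<Longrightarrow> p \<in> \<Omega> \<Longrightarrow> dird h (dx (u + v) f) p = dird h (dx u f) p
  + dird h (dx v f) p"
  by (subst dird_add[OF holo_on_dird[OF _ \<Omega>] holo_on_dird[OF _ \<Omega>], symmetric])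
    (auto intro!: dird_cong[OF \<Omega>] dx_add)

text \<open>
  The parts of degree two and three in \<open>v\<close> are quadratic forms in the derivatives; polarisation
  turns them into statements on mixed derivatives.
\<close>

lemma dx_polar:
  assumes "holo_on \<Omega> f" "p \<in> \<Omega>"
  shows "dx (u + v) (dx (u + v) f) p = dx u (dx u f) p + 2 * dx u (dx v f) p + dx v (dx v f) p"
  using dird_commute[OF assms(1) \<Omega> assms(2), of "(0, u)" "(0, v)"]
  by (simp add: dird_dx_add assms dx_add[OF holo_on_dird[OF assms(1) \<Omega>] assms(2)])

text \<open>
  Replacing \<open>v\<close> by \<open>z v\<close> makes the symmetry condition a cubic polynomial in \<open>z\<close>, whose
  coefficients vanish.
\<close>

lemma determining_equations:
  assumes p: "p \<in> \<Omega>"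
  shows "dt (dt (\<eta> b)) p + dx (J *v snd p) (\<eta> b) p - 2 * (J *v snd p) $ b * dt \<tau> p
         = (\<Sum>a\<in>UNIV. J $ b $ a * \<eta> a p)" (is ?c0)
    and "2 * dt (dx v (\<eta> b)) p = v $ b * (dt (dt \<tau>) p + dx (J *v snd p) \<tau> p)
      + 2 * (J *v snd p) $ b * dx v \<tau> p" (is ?c1)
    and "dx v (dx v (\<eta> b)) p = 2 * v $ b * dt (dx v \<tau>) p" (is ?c2)
    and "v $ b * dx v (dx v \<tau>) p = 0" (is ?c3)
proof -
  let ?a0 = "dt (dt (\<eta> b)) p + dx (J *v snd p) (\<eta> b) p - 2 * (J *v snd p) $ b * dt \<tau> p
      - (\<Sum>a\<in>UNIV. J $ b $ a * \<eta> a p)"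
  let ?a1 = "2 * dt (dx v (\<eta> b)) p - (v $ b * (dt (dt \<tau>) p + dx (J *v snd p) \<tau> p)
    + 2 * (J *v snd p) $ b * dx v \<tau> p)"
  let ?a2 = "dx v (dx v (\<eta> b)) p - 2 * v $ b * dt (dx v \<tau>) p"
  let ?a3 = "- (v $ b * dx v (dx v \<tau>) p)"
  have "?a0 + z * ?a1 + z * z * ?a2 + z * z * z * ?a3 = 0" for z
  proof -
    have *: "dx (z *s v) f p = z * dx v f p" if "holo_on \<Omega> f" for f
      by (rule dx_smult[OF that p])
    have **: "dt (dx (z *s v) f) p = z * dt (dx v f) p"
      "dx (z *s v) (dx (z *s v) f) p = z * z * dx v (dx v f) p" if "holo_on \<Omega> f" for f
      using dx_smult[OF holo_on_dird[OF that \<Omega>] p] by (simp_all add: dird_dx_smult that p)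
    show ?thesis
      using sym[OF p, where v = "z *s v" and b = b]
      unfolding *[OF T] **[OF T] **[OF X] vector_smult_component
      by (simp add: algebra_simps)
  qed
  from cubic_coeffs_zero[OF this] show ?c0 ?c1 ?c2 ?c3 by simp_all
qed

lemma tau_xx:
  assumes p: "p \<in> \<Omega>"
  shows "dx u (dx v \<tau>) p = 0"
proof -
  have diag: "dx w (dx w \<tau>) p = 0" for w
  proof (cases "w = 0")
    case True
    then show ?thesis using dx_smult[OF holo_on_dird[OF T \<Omega>] p, of 0 w] by simp
  next
    case False
    then obtain b where "w $ b \<noteq> 0" by (auto simp: vec_eq_iff)
    with determining_equations(4)[OF p, of w b] show ?thesis by simp
  qed
  show ?thesis using dx_polar[OF T p, of u v] by (simp add: diag)
qed

lemma eta_xx: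
  assumes p: "p \<in> \<Omega>"
  shows "dx u (dx v (\<eta> b)) p = u $ b * dt (dx v \<tau>) p + v $ b * dt (dx u \<tau>) p"
proof -
  have "dx u (dx u (\<eta> b)) p + 2 * dx u (dx v (\<eta> b)) p + dx v (dx v (\<eta> b)) p =
     2 * (u + v) $ b * (dt (dx u \<tau>) p + dt (dx v \<tau>) p)"
    using determining_equations(3)[OF p, of "u + v" b]
      by (simp only: dx_polar[OF X p] dird_dx_add[OF T p])
  then have "2 * dx u (dx v (\<eta> b)) p = 2 * (u $ b * dt (dx v \<tau>) p + v $ b * dt (dx u \<tau>) p)"
    by (simp add: determining_equations(3)[OF p] algebra_simps)
  then show ?thesis by (subst (asm) mult_cancel_left) simp
qed

lemmas holo_rules = holo_on_dird[OF _ \<Omega>] T X holo_on_add holo_on_diff holo_on_cmult holo_on_mult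
  holo_on_mult_vec_nth holo_on_dx_J[OF \<Omega>] holo_on_sum

text \<open>
  The derivative along \<open>u\<close> of the part of degree one in \<open>v\<close>, where the second \<open>x\<close>-derivatives of
  \<open>\<eta>\<close> are replaced according to the part of degree two.
\<close>

lemma compatibility_identity:
  assumes p: "p \<in> \<Omega>"
  shows "2 * (u $ b * dx v (dt (dt \<tau>)) p) + v $ b * dx u (dt (dt \<tau>)) p = v $ b * dx (J *v u) \<tau> p
    + 2 * ((J *v u) $ b * dx v \<tau> p)"
proof -
  have tt: "dt (dt (dx w \<tau>)) p = dx w (dt (dt \<tau>)) p" for w
  proof -
    have "dt (dt (dx w \<tau>)) p = dt (dx w (dt \<tau>)) p"
      by (rule dird_cong[OF \<Omega> dird_commute[OF T \<Omega>] p])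
    also have "\<dots> = dx w (dt (dt \<tau>)) p"
      by (rule dird_commute[OF holo_on_dird[OF T \<Omega>] \<Omega> p])
    finally show ?thesis .
  qed
  have "dx u (\<lambda>p. 2 * dt (dx v (\<eta> b)) p) p = 2 * dt (dx u (dx v (\<eta> b))) p"
    by (subst dird_cmult[OF _ p]) (simp_all add: holo_rules dird_commute[OF _ \<Omega> p])
  also have "dt (dx u (dx v (\<eta> b))) p = dt (\<lambda>p. u $ b * dt (dx v \<tau>) p + v $ b * dt (dx u \<tau>) p) p"
    by (rule dird_cong[OF \<Omega> eta_xx p])
  also have "\<dots> = u $ b * dx v (dt (dt \<tau>)) p + v $ b * dx u (dt (dt \<tau>)) p"
    by (subst dird_add[OF _ _ p]) (simp_all add: holo_rules dird_cmult[OF _ p] tt)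
  finally have lhs: "dx u (\<lambda>p. 2 * dt (dx v (\<eta> b)) p) p =
    2 * (u $ b * dx v (dt (dt \<tau>)) p + v $ b * dx u (dt (dt \<tau>)) p)" .
  have "dx u (\<lambda>p. 2 * dt (dx v (\<eta> b)) p) p = dx u (\<lambda>p. v $ b * (dt (dt \<tau>) p + dx (J *v snd p) \<tau> p)
    + 2 * (J *v snd p) $ b * dx v \<tau> p) p"
    by (rule dird_cong[OF \<Omega> determining_equations(2) p])
  also have "\<dots> = dx u (\<lambda>p. v $ b * (dt (dt \<tau>) p + dx (J *v snd p) \<tau> p)) p
    + dx u (\<lambda>p. 2 * (J *v snd p) $ b * dx v \<tau> p) p"
    by (rule dird_add[OF _ _ p]) (intro holo_rules)+
  also have "dx u (\<lambda>p. v $ b * (dt (dt \<tau>) p + dx (J *v snd p) \<tau> p)) p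
    = v $ b * (dx u (dt (dt \<tau>)) p + dx (J *v u) \<tau> p)"
    by (simp add: holo_rules dird_cmult[OF _ p] dird_add[OF _ _ p] dird_dx_J[OF \<Omega> T p] tau_xx[OF p])
  also have "dx u (\<lambda>p. 2 * (J *v snd p) $ b * dx v \<tau> p) p = 2 * (J *v u) $ b * dx v \<tau> p"
    by (simp add: mult.assoc holo_rules dird_cmult[OF _ p] dird_mult[OF _ _ p] dird_mult_vec_nth
      tau_xx[OF p])
  finally show ?thesis unfolding lhs by (simp add: algebra_simps)
qed

text \<open>
  Summing the compatibility identity over \<open>v = e\<^sub>b\<close> gives \<open>(n + 2) \<alpha>(u) = (n + 2) l(J u)\<close>; the
  terms with \<open>\<alpha>(u) v\<close> and \<open>l(J u) v\<close> then cancel, and \<open>\<alpha>(v) u = l(v) J u\<close> is left.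
\<close>

lemma tau_x:
  assumes p: "p \<in> \<Omega>"
  shows "dx v \<tau> p = 0"
proof (rule ccontr)
  assume nz: "dx v \<tau> p \<noteq> 0"
  have H: "holo_on \<Omega> (dt (dt \<tau>))" by (intro holo_rules)
  have trace: "dx u (dt (dt \<tau>)) p = dx (J *v u) \<tau> p" for u
  proof -
    have "(\<Sum>b\<in>UNIV. 2 * (u $ b * dx (axis b 1) (dt (dt \<tau>)) p) + axis b 1 $ b * dx u (dt (dt \<tau>)) p) =
      (\<Sum>b\<in>UNIV. axis b 1 $ b * dx (J *v u) \<tau> p + 2 * ((J *v u) $ b * dx (axis b 1) \<tau> p))"
      by (simp only: compatibility_identity[OF p])
    then have "(2 + of_nat CARD('n)) * dx u (dt (dt \<tau>)) p = (2 + of_nat CARD('n)) * dx (J *v u) \<tau> p"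
      unfolding sum.distrib sum_distrib_left[symmetric] dx_sum_axis[OF T p] dx_sum_axis[OF H p]
      by (simp add: axis_def algebra_simps)
    moreover have "(2 + of_nat CARD('n) :: complex) \<noteq> 0"
      by (metis add_eq_0_iff_both_eq_0 of_nat_0_eq_iff of_nat_add of_nat_numeral zero_neq_numeral)
    ultimately show ?thesis by simp
  qed
  have "(J *v u) $ b * dx v \<tau> p = dx v (dt (dt \<tau>)) p * u $ b" for u b
    using compatibility_identity[OF p, of u b v] by (simp add: trace mult.commute)
  from scalar_matrixI[OF this nz] nonscalar show False by contradiction
qed

lemma dird_dx_tau: "p \<in> \<Omega> \<Longrightarrow> dird h (dx v \<tau>) p = 0"
  by (subst dird_cong[OF \<Omega> tau_x]) (simp_all add: dird_const)

lemma eta_xx_zero: "p \<in> \<Omega> \<Longrightarrow> dx u (dx v (\<eta> b)) p = 0"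
  by (simp add: eta_xx dird_dx_tau)

lemma eta_tx: "p \<in> \<Omega> \<Longrightarrow> dt (dx v (\<eta> b)) p = v $ b / 2 * dt (dt \<tau>) p"
  using determining_equations(2)[of p v b] by (simp add: tau_x field_simps)

text \<open>
  The \<open>x\<close>-derivative of the part of degree zero in \<open>v\<close>: an equation for the matrix of first
  \<open>x\<close>-derivatives of \<open>\<eta>\<close>. For constant \<open>\<xi>\<^sub>t = c\<close> it becomes the commutator relation
  \<open>M J - J M = 2 c J\<close>.
\<close>

lemma linear_part_equation:
  assumes p: "p \<in> \<Omega>"
  shows "u $ b / 2 * dt (dt (dt \<tau>)) p + dx (J *v u) (\<eta> b) p - 2 * (J *v u) $ b * dt \<tau> p
    = (\<Sum>a\<in>UNIV. J $ b $ a * dx u (\<eta> a) p)"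
proof -
  have "dx u (\<lambda>p. dt (dt (\<eta> b)) p + dx (J *v snd p) (\<eta> b) p - 2 * (J *v snd p) $ b * dt \<tau> p) p
       = dx u (\<lambda>p. \<Sum>a\<in>UNIV. J $ b $ a * \<eta> a p) p"
    by (rule dird_cong[OF \<Omega> determining_equations(1) p])
  also have "\<dots> = (\<Sum>a\<in>UNIV. J $ b $ a * dx u (\<eta> a) p)"
    by (simp add: dird_sum[OF _ p] holo_rules dird_cmult[OF _ p])
  also have "dx u (\<lambda>p. dt (dt (\<eta> b)) p + dx (J *v snd p) (\<eta> b) p - 2 * (J *v snd p) $ b * dt \<tau> p) p
    = dx u (dt (dt (\<eta> b))) p + dx u (\<lambda>p. dx (J *v snd p) (\<eta> b) p) p - dx u
      (\<lambda>p. 2 * (J *v snd p) $ b * dt \<tau> p) p"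
    by (subst dird_diff[OF _ _ p]; (intro holo_rules)?)
      (subst dird_add[OF _ _ p]; (intro holo_rules)?; simp)
  also have "dx u (dt (dt (\<eta> b))) p = u $ b / 2 * dt (dt (dt \<tau>)) p"
  proof -
    have "dx u (dt (dt (\<eta> b))) p = dt (dx u (dt (\<eta> b))) p"
      by (rule dird_commute[OF _ \<Omega> p]) (intro holo_rules)
    also have "\<dots> = dt (dt (dx u (\<eta> b))) p"
      by (rule dird_cong[OF \<Omega> dird_commute[OF X \<Omega>] p])
    also have "\<dots> = dt (\<lambda>p. u $ b / 2 * dt (dt \<tau>) p) p"
      by (rule dird_cong[OF \<Omega> eta_tx p])
    also have "\<dots> = u $ b / 2 * dt (dt (dt \<tau>)) p"
      by (rule dird_cmult[OF _ p]) (intro holo_rules)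
    finally show ?thesis .
  qed
  also have "dx u (\<lambda>p. dx (J *v snd p) (\<eta> b) p) p = dx (J *v u) (\<eta> b) p"
    by (simp add: dird_dx_J[OF \<Omega> X p] eta_xx_zero[OF p])
  also have "dx u (\<lambda>p. 2 * (J *v snd p) $ b * dt \<tau> p) p = 2 * (J *v u) $ b * dt \<tau> p"
    by (simp add: mult.assoc holo_rules dird_cmult[OF _ p] dird_mult[OF _ _ p] dird_mult_vec_nth
        dird_commute[OF T \<Omega> p, of "(0, u)" "(1, 0)"] dird_dx_tau[OF p])
  finally show ?thesis .
qed

text \<open>
  The \<open>t\<close>-derivative of \<open>\<eta>\<^sub>x\<close> is the scalar matrix \<open>\<xi>\<^sub>t\<^sub>t / 2\<close>, which commutes with \<open>J\<close>.
  Differentiating the equation for \<open>\<eta>\<^sub>x\<close> in \<open>t\<close> therefore leaves only a multiple of \<open>J\<close> and a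
  multiple of the unit matrix.
\<close>

lemma tau_tt:
  assumes p: "p \<in> \<Omega>"
  shows "dt (dt \<tau>) p = 0"
proof (rule ccontr)
  assume nz: "dt (dt \<tau>) p \<noteq> 0"
  have "(J *v u) $ b * dt (dt \<tau>) p = dt (dt (dt (dt \<tau>))) p / 4 * u $ b" for u b
  proof -
    have "dt (\<lambda>p. u $ b / 2 * dt (dt (dt \<tau>)) p + dx (J *v u) (\<eta> b) p - 2 * (J *v u) $ b * dt \<tau> p) p
      = dt (\<lambda>p. \<Sum>a\<in>UNIV. J $ b $ a * dx u (\<eta> a) p) p"
      by (rule dird_cong[OF \<Omega> linear_part_equation p])
    also have "\<dots> = (\<Sum>a\<in>UNIV. J $ b $ a * (u $ a / 2 * dt (dt \<tau>) p))"
      by (simp add: dird_sum[OF _ p] holo_rules dird_cmult[OF _ p] eta_tx[OF p])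
    also have "\<dots> = (J *v u) $ b / 2 * dt (dt \<tau>) p"
      by (simp add: matrix_vector_mult_def sum_distrib_right sum_divide_distrib mult.assoc)
    also have "dt (\<lambda>p. u $ b / 2 * dt (dt (dt \<tau>)) p + dx (J *v u) (\<eta> b) p
      - 2 * (J *v u) $ b * dt \<tau> p) p
      = u $ b / 2 * dt (dt (dt (dt \<tau>))) p + (J *v u) $ b / 2 * dt (dt \<tau>) p - 2 * (J *v u) $ b * dt
        (dt \<tau>) p"
    proof (subst dird_diff[OF _ _ p])
      show "holo_on \<Omega> (\<lambda>p. u $ b / 2 * dt (dt (dt \<tau>)) p + dx (J *v u) (\<eta> b) p)"
        "holo_on \<Omega> (\<lambda>p. 2 * (J *v u) $ b * dt \<tau> p)" by (intro holo_rules)+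
      show "dt (\<lambda>p. u $ b / 2 * dt (dt (dt \<tau>)) p + dx (J *v u) (\<eta> b) p) p
        - dt (\<lambda>p. 2 * (J *v u) $ b * dt \<tau> p) p
        = u $ b / 2 * dt (dt (dt (dt \<tau>))) p + (J *v u) $ b / 2 * dt (dt \<tau>) p - 2 * (J *v u) $ b *
          dt (dt \<tau>) p"
        by (subst dird_add[OF _ _ p]; (intro holo_rules)?)
          (simp add: holo_rules dird_cmult[OF _ p] dird_divide[OF _ p] eta_tx[OF p])
    qed
    finally show ?thesis by (simp add: field_simps)
  qed
  from scalar_matrixI[OF this nz] nonscalar show False by contradiction
qed

text \<open>
  All derivatives of \<open>\<xi>\<^sub>t\<close> and of \<open>\<eta>\<^sub>x\<close> vanish, so both are constant on the connected domain. The
  remainder \<open>\<eta> - M x\<close> has no \<open>x\<close>-derivatives, but it need not be a function of \<open>t\<close> globally.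
\<close>

lemma symmetry_affine:
  assumes con: "connected \<Omega>"
  obtains c d M where "\<And>p. p \<in> \<Omega> \<Longrightarrow> \<tau> p = c * fst p + d"
    and "M ** J - J ** M = matscale (2 * c) J"
    and "\<And>u b p. p \<in> \<Omega> \<Longrightarrow> dx u (\<lambda>p. \<eta> b p - (M *v snd p) $ b) p = 0"
    and "\<And>b p. p \<in> \<Omega> \<Longrightarrow> dt (dt (\<lambda>p. \<eta> b p - (M *v snd p) $ b)) p =
      (\<Sum>a\<in>UNIV. J $ b $ a * (\<eta> a p - (M *v snd p) $ a))"
proof (cases "\<Omega> = {}")
  case True
  show ?thesis by (rule that[of 0 0 0]) (use True in \<open>simp_all add: vec_eq_iff matscale_def\<close>)
next
  case False
  then obtain p0 where p0: "p0 \<in> \<Omega>" by blast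
  have "dird h (dt \<tau>) p = 0" if p: "p \<in> \<Omega>" for p h
    unfolding dird_split[OF holo_on_dird[OF T \<Omega>] p, of h] tau_tt[OF p]
      dird_commute[OF T \<Omega> p, of "(0, snd h)" "(1, 0)"] dird_dx_tau[OF p] by simp
  then obtain c where c: "\<And>p. p \<in> \<Omega> \<Longrightarrow> dt \<tau> p = c"
    using holo_on_constant[OF holo_on_dird[OF T \<Omega>] \<Omega> con] by metis
  have "dird h (\<lambda>p. \<tau> p - c * fst p) p = 0" if p: "p \<in> \<Omega>" for p h
    by (simp add: dird_diff[OF T holo_on_cmult[OF holo_on_fst] p] dird_cmult[OF holo_on_fst p]
      dird_fst
        dird_split[OF T p, of h] c[OF p] tau_x[OF p])
  then obtain d where d: "\<And>p. p \<in> \<Omega> \<Longrightarrow> \<tau> p - c * fst p = d"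
    using holo_on_constant[OF holo_on_diff[OF T holo_on_cmult[OF holo_on_fst]] \<Omega> con] by metis
  define M where "M = (\<chi> b a. dx (axis a 1) (\<eta> b) p0)"
  have Mx: "dx u (\<eta> b) p = (M *v u) $ b" if p: "p \<in> \<Omega>" for u b p
  proof -
    have "dird h (dx u (\<eta> b)) p = 0" if p: "p \<in> \<Omega>" for p h
      unfolding dird_split[OF holo_on_dird[OF X \<Omega>] p, of h]
      by (simp add: eta_tx[OF p] tau_tt[OF p] eta_xx_zero[OF p])
    then obtain m where m: "\<And>p. p \<in> \<Omega> \<Longrightarrow> dx u (\<eta> b) p = m"
      using holo_on_constant[OF holo_on_dird[OF X \<Omega>] \<Omega> con] by metis
    have "dx u (\<eta> b) p = dx u (\<eta> b) p0" using m p p0 by simp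
    also have "\<dots> = (M *v u) $ b"
      by (simp add: M_def matrix_vector_mult_def mult.commute[of _ "u $ _"] dx_sum_axis[OF X p0])
    finally show ?thesis .
  qed
  have MJ: "(M *v (J *v u)) $ b - 2 * c * (J *v u) $ b = (J *v (M *v u)) $ b" for u b
  proof -
    have "dt (dt (dt \<tau>)) p0 = 0"
      using dird_cong[OF \<Omega> tau_tt p0] by (simp add: dird_const)
    with linear_part_equation[OF p0, of u b] show ?thesis
      by (simp add: Mx[OF p0] c[OF p0] matrix_vector_mult_def[of J "M *v u"] algebra_simps)
  qed
  have dM: "dird h (\<lambda>p. \<eta> b p - (M *v snd p) $ b) p = dird h (\<eta> b) p - (M *v snd h) $ b"
    if "p \<in> \<Omega>" for p h b
    by (simp add: dird_diff[OF X holo_on_mult_vec_nth that] dird_mult_vec_nth)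
  show ?thesis
  proof (rule that[of c d M])
    show "\<tau> p = c * fst p + d" if "p \<in> \<Omega>" for p using d[OF that] by (simp add: algebra_simps)
    have "(M ** J - J ** M) *v u = matscale (2 * c) J *v u" for u
    proof -
      have "(matscale (2 * c) J *v u) $ b = 2 * c * (J *v u) $ b" for b
        by (simp add: matscale_def matrix_vector_mult_def sum_distrib_left mult.assoc)
      then show ?thesis
        using MJ[of u]
          by (simp add: vec_eq_iff matrix_vector_mult_diff_rdistrib matrix_vector_mul_assoc
          algebra_simps)
    qed
    then show "M ** J - J ** M = matscale (2 * c) J"
      by (simp add: matrix_eq)
    show "dx u (\<lambda>p. \<eta> b p - (M *v snd p) $ b) p = 0" if "p \<in> \<Omega>" for u b p
      by (simp add: dM[OF that] Mx[OF that])
    show "dt (dt (\<lambda>p. \<eta> b p - (M *v snd p) $ b)) p =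
      (\<Sum>a\<in>UNIV. J $ b $ a * (\<eta> a p - (M *v snd p) $ a))" if p: "p \<in> \<Omega>" for b p
    proof -
      have "dt (dt (\<lambda>p. \<eta> b p - (M *v snd p) $ b)) p = dt (dt (\<eta> b)) p"
        by (rule dird_cong[OF \<Omega> _ p]) (simp add: dM)
      also have "\<dots> = (\<Sum>a\<in>UNIV. J $ b $ a * \<eta> a p)
        - ((M *v (J *v snd p)) $ b - 2 * c * (J *v snd p) $ b)"
        using determining_equations(1)[OF p, of b] unfolding Mx[OF p] c[OF p]
          by (simp add: algebra_simps)
      also have "(M *v (J *v snd p)) $ b - 2 * c * (J *v snd p) $ b
        = (\<Sum>a\<in>UNIV. J $ b $ a * (M *v snd p) $ a)"
        unfolding MJ by (simp add: matrix_vector_mult_def[of J])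
      finally show ?thesis by (simp add: sum_subtractf algebra_simps)
    qed
  qed
qed

end

section \<open>Uniqueness and initial data for linear systems\<close>

lemma deriv2_eq:
  assumes "open S" "\<And>z. z \<in> S \<Longrightarrow> (f has_field_derivative f1 z) (at z)"
    and "\<And>z. z \<in> S \<Longrightarrow> (f1 has_field_derivative f2 z) (at z)" and "z \<in> S"
  shows "(deriv ^^ 2) f z = f2 z"
proof -
  have "deriv (deriv f) z = deriv f1 z"
    using eventually_nhds_in_open[OF assms(1,4)]
    by (intro deriv_cong_ev refl) (auto elim!: eventually_mono intro: DERIV_imp_deriv assms(2))
  also have "\<dots> = f2 z" by (rule DERIV_imp_deriv[OF assms(3)[OF assms(4)]])
  finally show ?thesis by (simp add: numeral_2_eq_2)
qed

lemma higher_deriv_sum: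
  assumes "\<And>i. i \<in> I \<Longrightarrow> f i holomorphic_on S" "open S" "z \<in> S"
  shows "(deriv ^^ n) (\<lambda>w. \<Sum>i\<in>I. f i w) z = (\<Sum>i\<in>I. (deriv ^^ n) (f i) z)"
  using assms(1)
proof (induction I rule: infinite_finite_induct)
  case (insert i I)
  have "(deriv ^^ n) (\<lambda>w. f i w + (\<Sum>i\<in>I. f i w)) z = (deriv ^^ n) (f i) z
    + (deriv ^^ n) (\<lambda>w. \<Sum>i\<in>I. f i w) z"
    using insert.prems by (intro higher_deriv_add[OF _ _ assms(2,3)] holomorphic_intros) auto
  with insert show ?case by simp
qed simp_all

text \<open>
  The equation expresses every derivative at \<open>z\<^sub>0\<close> by derivatives that are two orders lower. With
  zero initial data all derivatives vanish there, and the identity theorem applies.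
\<close>

lemma linear_ode_unique:
  fixes y :: "'n::finite \<Rightarrow> complex \<Rightarrow> complex" and A :: "complex^'n^'n"
  assumes S: "open S" "connected S" and y: "\<And>i. y i holomorphic_on S"
    and ode: "\<And>i z. z \<in> S \<Longrightarrow> (deriv ^^ 2) (y i) z = (\<Sum>j\<in>UNIV. A $ i $ j * y j z)"
    and z0: "z0 \<in> S" "\<And>i. y i z0 = 0" "\<And>i. deriv (y i) z0 = 0" and z: "z \<in> S"
  shows "y i z = 0"
proof (rule holomorphic_fun_eq_0_on_connected[OF y S _ z0(1) z])
  have step: "(deriv ^^ (n + 2)) (y i) z0 = (\<Sum>j\<in>UNIV. A $ i $ j * (deriv ^^ n) (y j) z0)" for n i
  proof -
    have "(deriv ^^ (n + 2)) (y i) z0 = (deriv ^^ n) ((deriv ^^ 2) (y i)) z0"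
      by (simp only: funpow_add o_apply)
    also have "\<dots> = (deriv ^^ n) (\<lambda>z. \<Sum>j\<in>UNIV. A $ i $ j * y j z) z0"
      by (rule higher_deriv_transform_within_open[OF _ _ S(1) z0(1) ode])
        (auto intro!: holomorphic_intros holomorphic_higher_deriv y S)
    also have "\<dots> = (\<Sum>j\<in>UNIV. (deriv ^^ n) (\<lambda>z. A $ i $ j * y j z) z0)"
      by (rule higher_deriv_sum[OF _ S(1) z0(1)]) (intro holomorphic_intros y)
    finally show ?thesis by (simp add: higher_deriv_cmult[OF y z0(1) S(1)])
  qed
  have "(\<forall>i. (deriv ^^ n) (y i) z0 = 0) \<and> (\<forall>i. (deriv ^^ Suc n) (y i) z0 = 0)" for n
  proof (induction n)
    case 0
    then show ?case using z0 by simp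
  next
    case (Suc n)
    then show ?case using step[of n] by (simp add: numeral_2_eq_2)
  qed
  then show "(deriv ^^ n) (y i) z0 = 0" for n by blast
qed

lemma is_solution_linear_iff:
  "is_solution (linear_rhs J) \<phi> \<longleftrightarrow> (\<forall>a. (\<lambda>t. \<phi> t $ a) holomorphic_on UNIV) \<and>
     (\<forall>t a. (deriv ^^ 2) (\<lambda>s. \<phi> s $ a) t = (\<Sum>b\<in>UNIV. J $ a $ b * \<phi> t $ b))"
  by (simp add: is_solution_def linear_rhs_def matrix_vector_mult_def)

lemma is_solution_subspace: "ccurve.subspace {\<phi>. is_solution (linear_rhs J) \<phi>}"
proof (rule ccurve.subspaceI)
  show "0 \<in> {\<phi>. is_solution (linear_rhs J) \<phi>}"
    by (simp add: is_solution_linear_iff)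
next
  fix \<phi> \<psi> assume "\<phi> \<in> {\<phi>. is_solution (linear_rhs J) \<phi>}" "\<psi> \<in> {\<phi>. is_solution (linear_rhs J) \<phi>}"
  then show "\<phi> + \<psi> \<in> {\<phi>. is_solution (linear_rhs J) \<phi>}"
    by (auto simp: is_solution_linear_iff distrib_left sum.distrib
        higher_deriv_add[OF _ _ open_UNIV UNIV_I] intro!: holomorphic_intros)
next
  fix c \<phi> assume "\<phi> \<in> {\<phi>. is_solution (linear_rhs J) \<phi>}"
  then show "curvescale c \<phi> \<in> {\<phi>. is_solution (linear_rhs J) \<phi>}"
    by (auto simp: is_solution_linear_iff curvescale_def sum_distrib_left mult.left_commute
        higher_deriv_cmult[OF _ UNIV_I open_UNIV] intro!: holomorphic_intros)
qed

text \<open>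
  Value and first derivative are combined into one vector of length \<open>2 n\<close>, indexed by a sum type,
  so that the dimension theory of coordinate spaces applies.
\<close>

definition initial_data :: "complex \<Rightarrow> (complex \<Rightarrow> complex^'n::finite) \<Rightarrow> complex^('n + 'n)" where
  "initial_data t \<phi> = (\<chi> i. case i of Inl a \<Rightarrow> \<phi> t $ a | Inr a \<Rightarrow> deriv (\<lambda>s. \<phi> s $ a) t)"

lemma initial_data_eq_0:
  assumes "is_solution (linear_rhs J) \<phi>" "initial_data t \<phi> = 0"
  shows "\<phi> = 0"
proof -
  have "\<phi> t $ a = 0" "deriv (\<lambda>s. \<phi> s $ a) t = 0" for a
    using arg_cong[OF assms(2), of "\<lambda>v. v $ Inl a"] arg_cong[OF assms(2), of "\<lambda>v. v $ Inr a"]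
    by (simp_all add: initial_data_def)
  with assms(1)[unfolded is_solution_linear_iff] have "\<phi> s $ a = 0" for s a
    using linear_ode_unique[of UNIV "\<lambda>a t. \<phi> t $ a" J t s a] by (simp add: connected_UNIV)
  then show ?thesis by (simp add: fun_eq_iff vec_eq_iff)
qed

lemma initial_data_add:
  assumes "is_solution (linear_rhs J) \<phi>" "is_solution (linear_rhs J) \<psi>"
  shows "initial_data t (\<phi> + \<psi>) = initial_data t \<phi> + initial_data t \<psi>"
  using assms unfolding is_solution_linear_iff
  by (auto simp: initial_data_def vec_eq_iff split: sum.split
      intro!: deriv_add holomorphic_on_imp_differentiable_at[OF _ open_UNIV])

lemma initial_data_scale:
  assumes "is_solution (linear_rhs J) \<phi>"
  shows "initial_data t (curvescale c \<phi>) = c *s initial_data t \<phi>"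
  using assms unfolding is_solution_linear_iff
  by (auto simp: initial_data_def curvescale_def vec_eq_iff split: sum.split
      intro!: deriv_cmult holomorphic_on_imp_differentiable_at[OF _ open_UNIV])

lemma is_solution_sum:
  assumes "\<And>i. i \<in> I \<Longrightarrow> is_solution (linear_rhs J) (\<phi> i)"
  shows "is_solution (linear_rhs J) (\<Sum>i\<in>I. curvescale (c i) (\<phi> i))"
proof -
  have "(\<Sum>i\<in>I. curvescale (c i) (\<phi> i)) \<in> {\<phi>. is_solution (linear_rhs J) \<phi>}"
    by (rule ccurve.subspace_sum[OF is_solution_subspace],
        rule ccurve.subspace_scale[OF is_solution_subspace]) (simp add: assms)
  then show ?thesis by simp
qed

lemma initial_data_sum:
  assumes "\<And>i. i \<in> I \<Longrightarrow> is_solution (linear_rhs J) (\<phi> i)"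
  shows "initial_data t (\<Sum>i\<in>I. curvescale (c i) (\<phi> i)) = (\<Sum>i\<in>I. c i *s initial_data t (\<phi> i))"
  using assms
proof (induction I rule: infinite_finite_induct)
  case (insert i I)
  have sol: "is_solution (linear_rhs J) (\<Sum>j\<in>{i}. curvescale (c j) (\<phi> j))"
    "is_solution (linear_rhs J) (\<Sum>i\<in>I. curvescale (c i) (\<phi> i))"
    by (rule is_solution_sum, simp add: insert.prems)+
  have "initial_data t (\<Sum>j\<in>insert i I. curvescale (c j) (\<phi> j)) =
    initial_data t (curvescale (c i) (\<phi> i)) + initial_data t (\<Sum>i\<in>I. curvescale (c i) (\<phi> i))"
    unfolding sum.insert[OF insert.hyps] using sol
    by (intro initial_data_add[where J = J]) (simp_all only: sum.insert sum.empty finite.emptyI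
      empty_iff add_0_right not_False_eq_True)
  also have "\<dots> = c i *s initial_data t (\<phi> i) + (\<Sum>i\<in>I. c i *s initial_data t (\<phi> i))"
    using insert.IH insert.prems initial_data_scale[of J "\<phi> i"] by (simp only: insert_iff simp_thms)
  finally show ?case unfolding sum.insert[OF insert.hyps] .
qed (simp_all add: initial_data_def vec_eq_iff zero_fun_def split: sum.split)

text \<open>
  By uniqueness, taking initial data is injective on solutions. Hence it maps \<open>2 n\<close> linearly
  independent solutions to \<open>2 n\<close> linearly independent vectors of a space of dimension \<open>2 n\<close>.
\<close>

lemma fundamental_set_initial_data:
  fixes \<phi> :: "nat \<Rightarrow> complex \<Rightarrow> complex^'n::finite"
  assumes "fundamental_set (linear_rhs J) \<phi>"
  obtains \<psi> where "\<psi> \<in> ccurve.span (\<phi> ` {1..2 * CARD('n)})" "initial_data t \<psi> = w"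
proof -
  define I where "I = {1..2 * CARD('n)}"
  have I: "finite I" "card I = CARD('n + 'n)" by (simp_all add: I_def)
  have sol: "is_solution (linear_rhs J) (\<phi> m)" if "m \<in> I" for m
    using assms that by (auto simp: fundamental_set_def I_def)
  have inj: "inj_on \<phi> I" and ind: "ccurve.independent (\<phi> ` I)"
    using assms by (auto simp: fundamental_set_def I_def)
  have zero: "c m = 0" if "(\<Sum>m\<in>I. c m *s initial_data t (\<phi> m)) = 0" "m \<in> I" for c m
  proof -
    have "initial_data t (\<Sum>m\<in>I. curvescale (c m) (\<phi> m)) = 0"
      using that(1) by (simp only: initial_data_sum[OF sol])
    with is_solution_sum[OF sol] have "(\<Sum>m\<in>I. curvescale (c m) (\<phi> m)) = 0"
      by (rule initial_data_eq_0)
    then have "(\<Sum>v\<in>\<phi> ` I. curvescale (c (the_inv_into I \<phi> v)) v) = 0"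
      by (simp add: sum.reindex[OF inj] the_inv_into_f_f[OF inj])
    then have "c (the_inv_into I \<phi> (\<phi> m)) = 0"
      by (rule ccurve.independentD[OF ind finite_imageI[OF I(1)] subset_refl]) (use that(2) in simp)
    then show ?thesis using that(2) by (simp add: the_inv_into_f_f[OF inj])
  qed
  let ?d = "\<lambda>m. initial_data t (\<phi> m)"
  have injd: "inj_on ?d I"
  proof (rule inj_onI, rule ccontr)
    fix m m' assume *: "m \<in> I" "m' \<in> I" "?d m = ?d m'" "m \<noteq> m'"
    \<comment> \<open>Equal data at two indices would be a vanishing combination with coefficients \<open>1\<close> and \<open>-1\<close>.\<close>
    define c where "c = (\<lambda>k. if k = m then 1 else if k = m' then -1 else 0 :: complex)"
    have "(\<Sum>k\<in>I. c k *s ?d k) = (\<Sum>k\<in>{m, m'}. c k *s ?d k)"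
      by (rule sum.mono_neutral_right) (use * I in \<open>auto simp: c_def\<close>)
    also have "\<dots> = 0" using * by (simp add: c_def)
    finally show False using zero[of c m] * by (simp add: c_def)
  qed
  have indd: "vec.independent (?d ` I)"
  proof (rule vec.independent_if_scalars_zero)
    fix c x assume *: "(\<Sum>x\<in>?d ` I. c x *s x) = 0" "x \<in> ?d ` I"
    then have "(\<Sum>m\<in>I. c (?d m) *s ?d m) = 0" by (simp add: sum.reindex[OF injd])
    with zero[of "\<lambda>m. c (?d m)"] * show "c x = 0" by auto
  qed (use I in simp)
  have "vec.dim (UNIV :: (complex^('n + 'n)) set) = card (?d ` I)"
    using card_image[OF injd] by (simp only: I(2) vec_dim_card)
  then have "UNIV \<subseteq> vec.span (?d ` I)"
    by (intro vec.card_ge_dim_independent[OF _ indd]) auto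
  then have "w \<in> vec.span (?d ` I)" by blast
  then obtain c where "w = (\<Sum>x\<in>?d ` I. c x *s x)"
    unfolding vec.span_finite[OF finite_imageI[OF I(1)]] by auto
  then have "w = (\<Sum>m\<in>I. c (?d m) *s ?d m)" by (simp add: sum.reindex[OF injd])
  also have "\<dots> = initial_data t (\<Sum>m\<in>I. curvescale (c (?d m)) (\<phi> m))"
    by (simp only: initial_data_sum[OF sol])
  finally show ?thesis
    by (intro that[of "\<Sum>m\<in>I. curvescale (c (?d m)) (\<phi> m)"] ccurve.span_sum ccurve.span_scale
      ccurve.span_base)
      (auto simp: I_def)
qed

lemma span_imp_solution:
  assumes "fundamental_set (linear_rhs J) (\<phi> :: nat \<Rightarrow> complex \<Rightarrow> complex^'n::finite)"
    "\<psi> \<in> ccurve.span (\<phi> ` {1..2 * CARD('n)})"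
  shows "is_solution (linear_rhs J) \<psi>"
proof -
  have "ccurve.span (\<phi> ` {1..2 * CARD('n)}) \<subseteq> {\<phi>. is_solution (linear_rhs J) \<phi>}"
    using assms(1) by (intro ccurve.span_minimal is_solution_subspace)
      (auto simp: fundamental_set_def)
  then show ?thesis using assms(2) by blast
qed

text \<open>
  Along a complex line the functions satisfy a linear system in one variable, with the matrix \<open>J\<close>
  multiplied by the square of the \<open>t\<close>-component of the direction. Uniqueness for it shows that
  vanishing initial data spread from one point of a ball to the whole ball, and then through the
  connected domain.
\<close>

lemma flat_solution_unique:
  fixes g :: "'n::finite \<Rightarrow> complex \<times> (complex^'n) \<Rightarrow> complex" and J :: "complex^'n^'n"
  assumes \<Omega>: "open \<Omega>" "connected \<Omega>" and g: "\<And>b. holo_on \<Omega> (g b)"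
    and gx: "\<And>u b p. p \<in> \<Omega> \<Longrightarrow> dx u (g b) p = 0"
    and gtt: "\<And>b p. p \<in> \<Omega> \<Longrightarrow> dt (dt (g b)) p = (\<Sum>a\<in>UNIV. J $ b $ a * g a p)"
    and p0: "p0 \<in> \<Omega>" "\<And>b. g b p0 = 0" "\<And>b. dt (g b) p0 = 0" and "p \<in> \<Omega>"
  shows "g b p = 0"
proof -
  define P where "P p \<longleftrightarrow> (\<forall>b. g b p = 0 \<and> dt (g b) p = 0)" for p
  have "P p"
  proof (rule connected_induction_simple[OF \<Omega>(2) p0(1) \<open>p \<in> \<Omega>\<close>])
    show "P p0" using p0 by (simp add: P_def)
    fix a assume "a \<in> \<Omega>"
    then obtain e where e: "e > 0" "ball a e \<subseteq> \<Omega>" using \<Omega>(1) openE by blast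
    have zero: "g b r = 0" if q: "q \<in> ball a e" "P q" and r: "r \<in> ball a e" for q r b
    proof -
      \<comment> \<open>The line from \<open>q\<close>, reached at parameter \<open>0\<close>, to \<open>r\<close>, reached at parameter \<open>1\<close>.\<close>
      let ?h = "r - q"
      define S where "S = {z. q + pointscale z ?h \<in> ball a e}"
      have S_eq: "S = (\<lambda>z. pointscale z ?h) -` ball (a - q) e"
        by (auto simp: S_def dist_norm algebra_simps)
      have "open S"
        unfolding S_eq
          by (intro open_vimage open_ball linear_continuous_on bounded_linear_pointscale_left)
      have "connected S"
        unfolding S_eq by (intro convex_connected convex_linear_vimage convex_ball
            bounded_linear.linear[OF bounded_linear_pointscale_left])
      have S\<Omega>: "q + pointscale z ?h \<in> \<Omega>" if "z \<in> S" for z using that e by (auto simp: S_def)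
      define y where "y b z = g b (q + pointscale z ?h)" for b z
      have d: "dird ?h f p = fst ?h * dt f p" if "holo_on \<Omega> f" "p \<in> \<Omega>" "dx (snd ?h) f p = 0" for f p
        using dird_split[OF that(1,2), of ?h] that(3) by simp
      have y1: "(y b has_field_derivative fst ?h * dt (g b) (q + pointscale z ?h)) (at z)"
        if "z \<in> S" for b z
        unfolding y_def
          using holo_on_line[OF g S\<Omega>[OF that]] d[OF g S\<Omega>[OF that] gx[OF S\<Omega>[OF that]]] by simp
      have gtx: "dx u (dt (g b)) p = 0" if "p \<in> \<Omega>" for u b p
      proof -
        have "dx u (dt (g b)) p = dt (dx u (g b)) p" by (rule dird_commute[OF g \<Omega>(1) that])
        also have "\<dots> = dt (\<lambda>_. 0) p" by (rule dird_cong[OF \<Omega>(1) gx that])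
        finally show ?thesis by (simp add: dird_const)
      qed
      have y2: "((\<lambda>z. fst ?h * dt (g b) (q + pointscale z ?h)) has_field_derivative
          (\<Sum>j\<in>UNIV. matscale (fst ?h * fst ?h) J $ b $ j * y j z)) (at z)" if "z \<in> S" for b z
      proof -
        have "((\<lambda>z. dt (g b) (q + pointscale z ?h)) has_field_derivative
          fst ?h * (\<Sum>a\<in>UNIV. J $ b $ a * y a z)) (at z)"
          using holo_on_line[OF holo_on_dird[OF g[of b] \<Omega>(1), of "(1, 0)"] S\<Omega>[OF that]]
          unfolding d[OF holo_on_dird[OF g \<Omega>(1)] S\<Omega>[OF that] gtx[OF S\<Omega>[OF that]]]
            gtt[OF S\<Omega>[OF that]] y_def .
        from DERIV_cmult[OF this, of "fst ?h"] show ?thesis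
          by (simp add: matscale_def sum_distrib_left mult.assoc)
      qed
      have in01: "0 \<in> S" "1 \<in> S" using q r by (simp_all add: S_def)
      have "y b 1 = 0"
      proof (rule linear_ode_unique[OF \<open>open S\<close> \<open>connected S\<close> _ _ in01(1) _ _ in01(2)])
        show "y i holomorphic_on S" for i
          using y1 by (auto simp: holomorphic_on_open[OF \<open>open S\<close>])
        show "(deriv ^^ 2) (y i) z = (\<Sum>j\<in>UNIV. matscale (fst ?h * fst ?h) J $ i $ j * y j z)"
          if "z \<in> S" for i z
          by (rule deriv2_eq[OF \<open>open S\<close> y1 y2 that])
        show "y i 0 = 0" for i using q by (simp add: y_def P_def)
        show "deriv (y i) 0 = 0" for i
          using DERIV_imp_deriv[OF y1[OF in01(1)]] q by (simp add: P_def)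
      qed
      then show ?thesis by (simp add: y_def)
    qed
    have "P r" if "q \<in> ball a e" "P q" "r \<in> ball a e" for q r
      using zero[OF that] dird_cong[OF open_ball zero[OF that(1,2)] that(3)]
        by (simp add: P_def dird_const)
    note step = this
    show "\<exists>T. openin (top_of_set \<Omega>) T \<and> a \<in> T \<and> (\<forall>x\<in>T. \<forall>y\<in>T. P x \<longrightarrow> P y)"
    proof (intro exI conjI ballI impI)
      show "openin (top_of_set \<Omega>) (ball a e)"
        using e(2) by (simp only: openin_open_eq[OF \<Omega>(1)] open_ball simp_thms)
      show "a \<in> ball a e" using e(1) by simp
      show "P y" if "x \<in> ball a e" "y \<in> ball a e" "P x" for x y
        by (rule step[OF that(1,3,2)])
    qed
  qed
  then show ?thesis by (simp add: P_def)
qed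

text \<open>
  The solution with the same initial data at one point agrees with the given functions everywhere,
  although two points of \<open>\<Omega>\<close> with the same \<open>t\<close> need not be joined within the slice at that \<open>t\<close>.
\<close>

lemma flat_solution_extends:
  fixes f :: "'n::finite \<Rightarrow> complex \<times> (complex^'n) \<Rightarrow> complex" and J :: "complex^'n^'n"
  assumes fund: "fundamental_set (linear_rhs J) \<phi>"
    and \<Omega>: "open \<Omega>" "connected \<Omega>" "\<Omega> \<noteq> {}" and f: "\<And>b. holo_on \<Omega> (f b)"
    and fx: "\<And>u b p. p \<in> \<Omega> \<Longrightarrow> dx u (f b) p = 0"
    and ftt: "\<And>b p. p \<in> \<Omega> \<Longrightarrow> dt (dt (f b)) p = (\<Sum>a\<in>UNIV. J $ b $ a * f a p)"
  obtains \<psi> where "\<psi> \<in> ccurve.span (\<phi> ` {1..2 * CARD('n)})" "\<And>p b. p \<in> \<Omega> \<Longrightarrow> f b p = \<psi> (fst p) $ b"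
proof -
  obtain p0 where p0: "p0 \<in> \<Omega>" using \<Omega> by blast
  obtain \<psi> where \<psi>: "\<psi> \<in> ccurve.span (\<phi> ` {1..2 * CARD('n)})" and
    init: "initial_data (fst p0) \<psi> = (\<chi> i. case i of Inl a \<Rightarrow> f a p0 | Inr a \<Rightarrow> dt (f a) p0)"
    by (rule fundamental_set_initial_data[OF fund])
  have hol: "(\<lambda>t. \<psi> t $ b) holomorphic_on UNIV"
    and ode: "(deriv ^^ 2) (\<lambda>t. \<psi> t $ b) t = (\<Sum>a\<in>UNIV. J $ b $ a * \<psi> t $ a)" for b t
    using span_imp_solution[OF fund \<psi>] by (auto simp: is_solution_linear_iff)
  have init0: "f b p0 = \<psi> (fst p0) $ b" "dt (f b) p0 = deriv (\<lambda>s. \<psi> s $ b) (fst p0)" for b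
    using arg_cong[OF init, of "\<lambda>v. v $ Inl b"] arg_cong[OF init, of "\<lambda>v. v $ Inr b"]
    by (simp_all add: initial_data_def)
  have h\<psi>: "holo_on \<Omega> (\<lambda>p. \<psi> (fst p) $ b)" for b
    by (rule holo_on_compose_fst[OF hol])
  have d\<psi>: "dird h (\<lambda>p. \<psi> (fst p) $ b) p = fst h * deriv (\<lambda>s. \<psi> s $ b) (fst p)" for h b p
    by (rule dird_compose_fst[OF hol])
  have "f b p - \<psi> (fst p) $ b = 0" if "p \<in> \<Omega>" for b p
  proof (rule flat_solution_unique[OF \<Omega>(1,2) _ _ _ p0 _ _ that,
    where g = "\<lambda>b p. f b p - \<psi> (fst p) $ b" and J = J])
    show "holo_on \<Omega> (\<lambda>p. f b p - \<psi> (fst p) $ b)" for b by (intro holo_on_diff f h\<psi>)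
    have diff: "dird h (\<lambda>p. f b p - \<psi> (fst p) $ b) p = dird h (f b) p
      - fst h * deriv (\<lambda>s. \<psi> s $ b) (fst p)"
      if "p \<in> \<Omega>" for h b p
      by (simp only: dird_diff[OF f h\<psi> that] d\<psi>)
    show "dx u (\<lambda>p. f b p - \<psi> (fst p) $ b) p = 0" if "p \<in> \<Omega>" for u b p
      by (simp add: diff[OF that] fx[OF that])
    show "dt (dt (\<lambda>p. f b p - \<psi> (fst p) $ b)) p = (\<Sum>a\<in>UNIV. J $ b $ a * (f a p - \<psi> (fst p) $ a))"
      if p: "p \<in> \<Omega>" for b p
    proof -
      have hd: "deriv (\<lambda>s. \<psi> s $ b) holomorphic_on UNIV" by (intro holomorphic_deriv hol open_UNIV)
      have "dt (dt (\<lambda>p. f b p - \<psi> (fst p) $ b)) p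
        = dt (\<lambda>p. dt (f b) p - deriv (\<lambda>s. \<psi> s $ b) (fst p)) p"
        by (rule dird_cong[OF \<Omega>(1) _ p]) (simp add: diff)
      also have "\<dots> = dt (dt (f b)) p - deriv (deriv (\<lambda>s. \<psi> s $ b)) (fst p)"
        by (simp add: dird_diff[OF holo_on_dird[OF f \<Omega>(1)] holo_on_compose_fst[OF hd] p]
          dird_compose_fst[OF hd])
      also have "deriv (deriv (\<lambda>s. \<psi> s $ b)) (fst p) = (\<Sum>a\<in>UNIV. J $ b $ a * \<psi> (fst p) $ a)"
        using ode[of b "fst p"] by (simp add: numeral_2_eq_2)
      finally show ?thesis by (simp add: ftt[OF p] right_diff_distrib sum_subtractf)
    qed
    show "f b p0 - \<psi> (fst p0) $ b = 0" for b by (simp add: init0)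
    show "dt (\<lambda>p. f b p - \<psi> (fst p) $ b) p0 = 0" for b by (simp add: diff[OF p0] init0)
  qed
  then have "f b p = \<psi> (fst p) $ b" if "p \<in> \<Omega>" for b p
    using that by simp
  then show ?thesis by (rule that[OF \<psi>])
qed

section \<open>Commutators and nilpotency\<close>

lemma matrix_mult_add_left: "(A + B) ** C = A ** C + B ** (C :: complex^'n^'n)"
  by (simp add: vec_eq_iff matrix_matrix_mult_def distrib_right sum.distrib)

lemma matrix_mult_diff_left: "(A - B) ** C = A ** C - B ** (C :: complex^'n^'n)"
  by (simp add: vec_eq_iff matrix_matrix_mult_def left_diff_distrib sum_subtractf)

lemma matrix_mult_diff_right: "A ** (B - C) = A ** B - A ** (C :: complex^'n^'n)"
  by (simp add: vec_eq_iff matrix_matrix_mult_def right_diff_distrib sum_subtractf)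

lemma matscale_mult_left: "matscale c A ** B = matscale c (A ** B)"
  by (simp add: vec_eq_iff matscale_def matrix_matrix_mult_def sum_distrib_left mult.assoc)

lemma matscale_mult_right: "A ** matscale c B = matscale c (A ** B)"
  by (simp add: vec_eq_iff matscale_def matrix_matrix_mult_def sum_distrib_left mult.left_commute)

lemma norm_matscale: "norm (matscale c A) = norm c * norm A"
proof -
  have "matscale c A $ i = c *s A $ i" for i
    by (simp add: matscale_def vec_eq_iff)
  then show ?thesis
    unfolding norm_vec_def[of A] norm_vec_def[of "matscale c A"]
      L2_set_right_distrib[OF norm_ge_zero]
    by (simp only: norm_vector_smult)
qed

lemma bounded_bilinear_matrix_mult:
  "bounded_bilinear (\<lambda>(A :: complex^'n^'n) B. A ** (B :: complex^'n^'n))"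
proof -
  have "bilinear (\<lambda>(A :: complex^'n^'n) B. A ** (B :: complex^'n^'n))"
    unfolding bilinear_def
    by (intro conjI allI linearI matrix_add_ldistrib matrix_mult_add_left)
      (simp_all add: vec_eq_iff matrix_matrix_mult_def scaleR_sum_right)
  then show ?thesis by (simp only: bilinear_conv_bounded_bilinear)
qed

definition mpow :: "complex^'n^'n \<Rightarrow> nat \<Rightarrow> complex^'n^'n" where
  "mpow J k = ((\<lambda>A. J ** A) ^^ k) (Finite_Cartesian_Product.mat 1)"

lemma mpow_simps [simp]: "mpow J 0 = Finite_Cartesian_Product.mat 1" "mpow J (Suc k)
  = J ** mpow J k"
  by (simp_all add: mpow_def)

lemma nilpotent_matrix_iff: "nilpotent_matrix J \<longleftrightarrow> (\<exists>k. mpow J k = 0)"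
  by (simp add: nilpotent_matrix_def mpow_def)

text \<open>
  Commutation with \<open>M\<close> is a derivation, so \<open>J\<close> being an eigenvector for \<open>c\<close> makes \<open>J\<^sup>k\<close> one for
  \<open>k c\<close>, unless it vanishes.
\<close>

lemma commutator_mpow:
  assumes "M ** J - J ** M = matscale c J"
  shows "M ** mpow J k - mpow J k ** M = matscale (of_nat k * c) (mpow J k)"
proof (induction k)
  case 0
  then show ?case by (simp add: matscale_def vec_eq_iff)
next
  case (Suc k)
  let ?P = "mpow J k"
  have "M ** (J ** ?P) - (J ** ?P) ** M = (M ** J - J ** M) ** ?P + J ** (M ** ?P - ?P ** M)"
    by (simp only: matrix_mult_diff_left matrix_mult_diff_right matrix_mul_assoc) simp
  also have "\<dots> = matscale (of_nat (Suc k) * c) (J ** ?P)"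
    unfolding Suc assms matscale_mult_left matscale_mult_right
    by (simp add: matscale_def vec_eq_iff algebra_simps)
  finally show ?case by simp
qed

text \<open>
  The norm of the commutator of \<open>M\<close> with any matrix is at most a fixed multiple of the norm of
  that matrix, whereas the factor \<open>k c\<close> grows without bound.
\<close>

lemma nilpotent_if_commutator:
  assumes M: "M ** J - J ** M = matscale c J" and "c \<noteq> 0"
  shows "nilpotent_matrix J"
proof -
  obtain K where K: "\<And>(A :: complex^'a^'a) B. norm (A ** (B :: complex^'a^'a))
    \<le> norm A * norm B * K"
    using bounded_bilinear.bounded[OF bounded_bilinear_matrix_mult] by blast
  \<comment> \<open>Beyond this \<open>k\<close> the eigenvalue \<open>k c\<close> exceeds the bound \<open>2 K \<parallel>M\<parallel>\<close> of the commutator.\<close>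
  obtain k :: nat where k: "2 * K * norm M / norm c < real k"
    using reals_Archimedean2 by blast
  let ?P = "mpow J k"
  have "real k * norm c * norm ?P = norm (matscale (of_nat k * c) ?P)"
    by (simp add: norm_matscale norm_mult)
  also have "\<dots> \<le> norm (M ** ?P) + norm (?P ** M)"
    unfolding commutator_mpow[OF M, symmetric] by (rule norm_triangle_ineq4)
  also have "\<dots> \<le> 2 * K * norm M * norm ?P"
    using K[of M ?P] K[of ?P M] by (simp add: algebra_simps)
  finally have "(real k * norm c - 2 * K * norm M) * norm ?P \<le> 0"
    by (simp add: algebra_simps)
  moreover have "real k * norm c - 2 * K * norm M > 0"
    using k \<open>c \<noteq> 0\<close> by (simp add: field_simps)
  ultimately have "norm ?P \<le> 0"
    by (simp add: mult_le_0_iff)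
  then show ?thesis unfolding nilpotent_matrix_iff by auto
qed

text \<open>
  The diagonal entries of the powers of a triangular matrix are the powers of its diagonal
  entries.
\<close>

lemma nilpotent_triangular_diag:
  fixes J :: "complex^'n^'n" and pos :: "'n \<Rightarrow> nat"
  assumes inj: "inj pos" and tri: "\<And>a b. pos b < pos a \<Longrightarrow> J $ a $ b = 0" and "nilpotent_matrix J"
  shows "J $ a $ a = 0"
proof -
  have P: "(pos b < pos a \<longrightarrow> mpow J k $ a $ b = 0) \<and> mpow J k $ a $ a = (J $ a $ a) ^ k" for k a b
  proof (induction k arbitrary: a b)
    case 0
    then show ?case by (auto simp: Finite_Cartesian_Product.mat_def)
  next
    case (Suc k)
    have low: "J $ a $ c * mpow J k $ c $ b = 0" if "pos b < pos a" for c
      using Suc[of b c] tri[of c a] that by (cases "pos c < pos a") auto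
    have "J $ a $ c * mpow J k $ c $ a = 0" if "c \<noteq> a" for c
      using Suc[of a c] tri[of c a] injD[OF inj, of c a] that by (cases "pos c < pos a") auto
    then have "(\<Sum>c\<in>UNIV. J $ a $ c * mpow J k $ c $ a) = (\<Sum>c\<in>{a}. J $ a $ c * mpow J k $ c $ a)"
      by (intro sum.mono_neutral_right) auto
    moreover have "(\<Sum>c\<in>UNIV. J $ a $ c * mpow J k $ c $ b) = 0" if "pos b < pos a"
      by (intro sum.neutral ballI low that)
    ultimately show ?case using Suc[of a a] by (simp add: matrix_matrix_mult_def)
  qed
  obtain k where "mpow J k = 0" using assms(3) unfolding nilpotent_matrix_iff by blast
  then have "(J $ a $ a) ^ k = 0" using P[of a a k] by simp
  then show ?thesis by simp
qed

section \<open>The Jordan form and its grading\<close>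

text \<open>
  The diagonal of \<open>\<gamma>\<close>: the position of each coordinate within its Jordan block, counted from \<open>1\<close>.
\<close>

definition block_positions :: "(nat \<times> complex) list \<Rightarrow> nat list" where
  "block_positions bl = concat (map (\<lambda>(k, lam). [1..<Suc k]) bl)"

lemma jordan_matrix_Cons:
  "jordan_matrix ((k, lam) # bl) = four_block_mat (jordan_block k lam)
    (0\<^sub>m k (sum_list (map fst bl)))
     (0\<^sub>m (sum_list (map fst bl)) k) (jordan_matrix bl)"
proof -
  have "jordan_matrix ((k, lam) # bl) = (let A = jordan_block k lam; B = jordan_matrix bl
     in four_block_mat A (0\<^sub>m (dim_row A) (dim_col B)) (0\<^sub>m (dim_row B) (dim_col A)) B)"
    by (simp only: jordan_matrix_def list.map prod.case diag_block_mat.simps Let_def)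
  then show ?thesis by (simp add: Let_def)
qed

text \<open>
  Off the diagonal, a nonzero entry can occur only between neighbouring positions of one block.
\<close>

lemma jordan_matrix_offdiag:
  assumes "i < sum_list (map fst bl)" "j < sum_list (map fst bl)" "i \<noteq> j"
    "jordan_matrix bl $$ (i, j) \<noteq> 0"
  shows "block_positions bl ! j = Suc (block_positions bl ! i)"
  using assms
proof (induction bl arbitrary: i j)
  case (Cons kl bl)
  obtain k lam where kl: "kl = (k, lam)" by force
  note J = jordan_matrix_Cons[of k lam bl, folded kl]
  have g: "block_positions (kl # bl) ! m
    = (if m < k then Suc m else block_positions bl ! (m - k))" for m
    by (simp add: block_positions_def kl nth_append nth_upt del: upt_Suc)
  show ?case
  proof (cases "i < k \<and> j < k")
    case True
    then show ?thesis using Cons.prems unfolding J by (auto simp: g split: if_splits)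
  next
    case False
    with Cons.prems have ij: "\<not> i < k" "\<not> j < k" and nz: "jordan_matrix bl $$ (i - k, j - k) \<noteq> 0"
      unfolding J by (auto simp: kl split: if_splits)
    have "block_positions bl ! (j - k) = Suc (block_positions bl ! (i - k))"
      by (rule Cons.IH[OF _ _ _ nz]) (use ij Cons.prems in \<open>auto simp: kl\<close>)
    then show ?thesis using ij by (simp add: g)
  qed
qed simp

text \<open>
  The commutator with the diagonal matrix \<open>\<gamma>\<close> multiplies the entry at \<open>(a, b)\<close> by the difference
  of the diagonal entries at \<open>b\<close> and \<open>a\<close>. For nilpotent \<open>J\<close> only superdiagonal entries within
  blocks are left, and there this difference is \<open>1\<close>.
\<close>

lemma gamma_commutator:
  fixes pos :: "'n::finite \<Rightarrow> nat"
  assumes pos: "bij_betw pos UNIV {..<CARD('n)}" and bl: "sum_list (map fst bl) = CARD('n)"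
    and nil: "nilpotent_matrix (jordan_form pos bl)"
  shows "jordan_form pos bl ** gamma_matrix pos bl - gamma_matrix pos bl ** jordan_form pos bl
    = jordan_form pos bl"
proof -
  let ?J = "jordan_form pos bl" and ?G = "gamma_matrix pos bl" and ?g = "block_positions bl"
  have pos_less: "pos a < sum_list (map fst bl)" for a
    using bij_betw_apply[OF pos, of a] bl by simp
  have inj: "inj pos" using pos by (rule bij_betw_imp_inj_on)
  have "?J $ a $ b * (of_nat (?g ! pos b) - of_nat (?g ! pos a)) = ?J $ a $ b" for a b
  proof (cases "a = b")
    case True
    have "?J $ a $ a = 0"
    proof (rule nilpotent_triangular_diag[OF inj _ nil])
      show "?J $ a $ b = 0" if "pos b < pos a" for a b
        using jordan_matrix_upper_triangular[OF pos_less that] by (simp add: jordan_form_def)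
    qed
    then show ?thesis using True by simp
  next
    case False
    then have "pos a \<noteq> pos b" using inj by (auto dest: injD)
    then show ?thesis
      using jordan_matrix_offdiag[OF pos_less pos_less, of a b]
      by (cases "?J $ a $ b = 0") (auto simp: jordan_form_def)
  qed
  moreover have G: "?G = (\<chi> a b. if a = b then of_nat (?g ! pos a) else 0)"
    by (simp only: gamma_matrix_def block_positions_def)
  have "(?J ** ?G) $ a $ b = ?J $ a $ b * of_nat (?g ! pos b)"
    and "(?G ** ?J) $ a $ b = of_nat (?g ! pos a) * ?J $ a $ b" for a b
    unfolding G by (simp_all add: matrix_matrix_mult_def if_distrib[of "(*) _"] if_distrib[of
      "\<lambda>x. x * _"] cong: if_cong)
  ultimately show ?thesis
    by (simp add: vec_eq_iff right_diff_distrib mult.commute)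
qed

section \<open>The symmetry algebra\<close>

lemma holomorphic_vf_iff:
  "holomorphic_vf \<Omega> Q \<longleftrightarrow> holo_on \<Omega> (tcomp Q) \<and> (\<forall>b. holo_on \<Omega> (xcomp Q b))"
proof
  assume Q: "holomorphic_vf \<Omega> Q"
  have nth: "bounded_linear (\<lambda>h :: complex \<times> (complex^'a). snd h $ b)" for b
    by (rule bounded_linear_compose[OF bounded_linear_vec_nth bounded_linear_snd])
  show "holo_on \<Omega> (tcomp Q) \<and> (\<forall>b. holo_on \<Omega> (xcomp Q b))"
    unfolding holo_on_def
  proof (intro conjI allI ballI)
    fix p b assume "p \<in> \<Omega>"
    then obtain Q' where Q': "(Q has_derivative Q') (at p)" "\<forall>c h. Q' (pointscale c h)
      = pointscale c (Q' h)"
      using Q unfolding holomorphic_vf_def by blast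
    show "\<exists>f'. (tcomp Q has_derivative f') (at p) \<and> (\<forall>c h. f' (pointscale c h) = c * f' h)"
      unfolding tcomp_def[abs_def] using has_derivative_fst[OF Q'(1)] Q'(2)
      by (intro exI[of _ "\<lambda>h. fst (Q' h)"]) (simp only: pointscale_simps simp_thms)
    show "\<exists>f'. (xcomp Q b has_derivative f') (at p) \<and> (\<forall>c h. f' (pointscale c h) = c * f' h)"
      unfolding xcomp_def[abs_def] using bounded_linear.has_derivative[OF nth Q'(1)] Q'(2)
      by (intro exI[of _ "\<lambda>h. snd (Q' h) $ b"])
        (simp only: pointscale_simps vector_smult_component simp_thms)
  qed
next
  assume Q: "holo_on \<Omega> (tcomp Q) \<and> (\<forall>b. holo_on \<Omega> (xcomp Q b))"
  show "holomorphic_vf \<Omega> Q"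
    unfolding holomorphic_vf_def
  proof (intro ballI exI conjI allI)
    fix p assume p: "p \<in> \<Omega>"
    have T: "(tcomp Q has_derivative (\<lambda>h. dird h (tcomp Q) p)) (at p)"
      and X: "\<And>b. (xcomp Q b has_derivative (\<lambda>h. dird h (xcomp Q b) p)) (at p)"
      using Q p by (auto intro: holo_on_has_derivative)
    have "((\<lambda>p. \<chi> b. xcomp Q b p) has_derivative (\<lambda>h. \<chi> b. dird h (xcomp Q b) p)) (at p)"
      unfolding has_derivative_componentwise_within[of "\<lambda>p. \<chi> b. xcomp Q b p"]
      by (auto simp: Basis_vec_def inner_axis intro!: bounded_linear.has_derivative[OF
        bounded_linear_inner_left X])
    from has_derivative_Pair[OF T this]
    show "(Q has_derivative (\<lambda>h. (dird h (tcomp Q) p, \<chi> b. dird h (xcomp Q b) p))) (at p)"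
      by (simp add: tcomp_def xcomp_def)
    show "(dird (pointscale c h) (tcomp Q) p, \<chi> b. dird (pointscale c h) (xcomp Q b) p) =
      pointscale c (dird h (tcomp Q) p, \<chi> b. dird h (xcomp Q b) p)" for c h
      using Q p by (simp add: dird_pointscale[of \<Omega>] prod_eq_iff vec_eq_iff)
  qed
qed

definition affine_vf :: "complex \<Rightarrow> complex \<Rightarrow> complex^'n^'n \<Rightarrow> (complex \<Rightarrow> complex^'n)
  \<Rightarrow> 'n::finite vfield" where
  "affine_vf c d M \<psi> = (\<lambda>(t, x). (c * t + d, M *v x + \<psi> t))"

lemma affine_vf_symmetry:
  assumes \<Omega>: "open \<Omega>" and \<psi>: "is_solution (linear_rhs J) \<psi>"
    and M: "M ** J - J ** M = matscale (2 * c) J"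
  shows "vf_on \<Omega> (affine_vf c d M \<psi>) \<in> max_lie_invariance_algebra \<Omega> (linear_rhs J)"
proof -
  let ?Q = "vf_on \<Omega> (affine_vf c d M \<psi>)"
  have hol: "(\<lambda>t. \<psi> t $ b) holomorphic_on UNIV"
    and ode: "deriv (deriv (\<lambda>t. \<psi> t $ b)) t = (J *v \<psi> t) $ b" for b t
    using \<psi> by (auto simp: is_solution_linear_iff numeral_2_eq_2 matrix_vector_mult_def)
  have hd: "deriv (\<lambda>t. \<psi> t $ b) holomorphic_on UNIV" for b
    by (intro holomorphic_deriv hol open_UNIV)
  have t: "c * fst p + d = tcomp ?Q p" and x: "(M *v snd p) $ b + \<psi> (fst p) $ b = xcomp ?Q b p"
    if "p \<in> \<Omega>" for p b
    using that by (simp_all add: tcomp_def xcomp_def vf_on_def affine_vf_def split_beta)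
  have h: "holo_on \<Omega> (\<lambda>p. c * fst p + d)" "holo_on \<Omega> (\<lambda>p. (M *v snd p) $ b + \<psi> (fst p) $ b)" for b
    by (intro holo_on_add holo_on_cmult holo_on_fst holo_on_const holo_on_mult_vec_nth
      holo_on_compose_fst[OF hol])+
  have T: "holo_on \<Omega> (tcomp ?Q)" and X: "holo_on \<Omega> (xcomp ?Q b)" for b
    by (rule holo_on_cong[OF \<Omega> t h(1)], assumption) (rule holo_on_cong[OF \<Omega> x h(2)])
  have dT: "dird k (tcomp ?Q) p = c * fst k" if "p \<in> \<Omega>" for k p
  proof -
    have "dird k (tcomp ?Q) p = dird k (\<lambda>p. c * fst p + d) p"
      by (rule dird_cong[OF \<Omega> t[symmetric] that])
    also have "\<dots> = c * fst k"
      by (simp add: dird_add[OF holo_on_cmult[OF holo_on_fst] holo_on_const that]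
        dird_cmult[OF holo_on_fst that] dird_fst dird_const)
    finally show ?thesis .
  qed
  have dX: "dird k (xcomp ?Q b) p = (M *v snd k) $ b + fst k * deriv (\<lambda>t. \<psi> t $ b) (fst p)"
    if "p \<in> \<Omega>" for k p b
  proof -
    have "dird k (xcomp ?Q b) p = dird k (\<lambda>p. (M *v snd p) $ b + \<psi> (fst p) $ b) p"
      by (rule dird_cong[OF \<Omega> x[symmetric] that])
    also have "\<dots> = (M *v snd k) $ b + fst k * deriv (\<lambda>t. \<psi> t $ b) (fst p)"
      by (simp add: dird_add[OF holo_on_mult_vec_nth holo_on_compose_fst[OF hol] that]
        dird_mult_vec_nth dird_compose_fst[OF hol])
    finally show ?thesis .
  qed
  have dTT: "dird j (dird k (tcomp ?Q)) p = 0" if "p \<in> \<Omega>" for j k p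
    by (subst dird_cong[OF \<Omega> dT that]) (simp_all add: dird_const)
  have dXX: "dird j (dird k (xcomp ?Q b)) p = fst k * fst j * (J *v \<psi> (fst p)) $ b" if "p \<in> \<Omega>"
    for j k p b
  proof -
    have "dird j (dird k (xcomp ?Q b)) p = dird j (\<lambda>p. (M *v snd k) $ b
      + fst k * deriv (\<lambda>t. \<psi> t $ b) (fst p)) p"
      by (rule dird_cong[OF \<Omega> dX that])
    also have "\<dots> = fst k * (fst j * deriv (deriv (\<lambda>t. \<psi> t $ b)) (fst p))"
      by (simp add: dird_add[OF holo_on_const holo_on_cmult[OF holo_on_compose_fst[OF hd]] that]
          dird_cmult[OF holo_on_compose_fst[OF hd] that] dird_compose_fst[OF hd] dird_const)
    finally show ?thesis by (simp add: ode mult.assoc)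
  qed
  have "lie_symmetry \<Omega> (linear_rhs J) ?Q"
    unfolding lie_symmetry_linear_iff[OF \<Omega> T X]
  proof (intro ballI allI)
    fix p v b assume p: "p \<in> \<Omega>"
    have "(M *v (J *v y)) $ b - (J *v (M *v y)) $ b = 2 * c * (J *v y) $ b" for y
    proof -
      have "(M ** J - J ** M) *v y = matscale (2 * c) J *v y" by (simp only: M)
      then have "((M ** J - J ** M) *v y) $ b = (matscale (2 * c) J *v y) $ b" by simp
      then show ?thesis
        by (simp add: matrix_vector_mult_diff_rdistrib matrix_vector_mul_assoc)
          (simp add: matscale_def matrix_vector_mult_def sum_distrib_left mult.assoc)
    qed
    from this[of "snd p"]
    have "(M *v (J *v snd p)) $ b = (J *v (M *v snd p)) $ b + 2 * c * (J *v snd p) $ b"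
      by (simp add: algebra_simps)
    moreover have "(\<Sum>a\<in>UNIV. J $ b $ a * xcomp ?Q a p) = (J *v (M *v snd p)) $ b
      + (J *v \<psi> (fst p)) $ b"
      by (simp add: x[OF p, symmetric] matrix_vector_mult_def[of J] distrib_left sum.distrib)
    ultimately show "dt (dt (xcomp ?Q b)) p + 2 * dt (dx v (xcomp ?Q b)) p
      + dx v (dx v (xcomp ?Q b)) p
      - v $ b * (dt (dt (tcomp ?Q)) p + 2 * dt (dx v (tcomp ?Q)) p + dx v (dx v (tcomp ?Q)) p)
      + dx (J *v snd p) (xcomp ?Q b) p
      - 2 * (J *v snd p) $ b * (dt (tcomp ?Q) p + dx v (tcomp ?Q) p)
      - v $ b * dx (J *v snd p) (tcomp ?Q) p
     = (\<Sum>a\<in>UNIV. J $ b $ a * xcomp ?Q a p)"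
      by (simp add: dT[OF p] dX[OF p] dTT[OF p] dXX[OF p])
  qed
  then show ?thesis
    unfolding max_lie_invariance_algebra_def holomorphic_vf_iff using T X by (simp add: vf_on_def)
qed

text \<open>
  This parametrisation of the algebra is valid for nilpotent and non-nilpotent \<open>J\<close> alike;
  nilpotency only decides whether \<open>c\<close> can be different from \<open>0\<close>.
\<close>

lemma max_lie_invariance_algebra_linear:
  fixes J :: "complex^'n::finite^'n"
  assumes op: "open \<Omega>" and con: "connected \<Omega>" and ne: "\<Omega> \<noteq> {}"
    and nonscalar: "J \<notin> cmat.span {Finite_Cartesian_Product.mat 1}"
    and fund: "fundamental_set (linear_rhs J) \<phi>"
  shows "max_lie_invariance_algebra \<Omega> (linear_rhs J) =
    {vf_on \<Omega> (affine_vf c d M \<psi>) | c d M \<psi>.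
      M ** J - J ** M = matscale (2 * c) J \<and> \<psi> \<in> ccurve.span (\<phi> ` {1..2 * CARD('n)})}"
    (is "?L = ?R")
proof
  show "?R \<subseteq> ?L"
    using affine_vf_symmetry[OF op span_imp_solution[OF fund]] by blast
  show "?L \<subseteq> ?R"
  proof
    fix Q assume "Q \<in> ?L"
    then have out: "\<And>p. p \<notin> \<Omega> \<Longrightarrow> Q p = 0" and T: "holo_on \<Omega> (tcomp Q)"
      and X: "\<And>b. holo_on \<Omega> (xcomp Q b)"
      and sym: "lie_symmetry \<Omega> (linear_rhs J) Q"
      unfolding max_lie_invariance_algebra_def holomorphic_vf_iff by auto
    interpret symmetry_pde \<Omega> "tcomp Q" "xcomp Q" J
      by unfold_locales (use op T X nonscalar sym[unfolded lie_symmetry_linear_iff[OF op T X]] in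
        blast)+
    show "Q \<in> ?R"
    proof (rule symmetry_affine[OF con])
      fix c d M
      assume c: "\<And>p. p \<in> \<Omega> \<Longrightarrow> tcomp Q p = c * fst p + d"
        and M: "M ** J - J ** M = matscale (2 * c) J"
        and fx: "\<And>u b p. p \<in> \<Omega> \<Longrightarrow> dx u (\<lambda>p. xcomp Q b p - (M *v snd p) $ b) p = 0"
        and ftt: "\<And>b p. p \<in> \<Omega> \<Longrightarrow> dt (dt (\<lambda>p. xcomp Q b p - (M *v snd p) $ b)) p =
          (\<Sum>a\<in>UNIV. J $ b $ a * (xcomp Q a p - (M *v snd p) $ a))"
      obtain \<psi> where \<psi>: "\<psi> \<in> ccurve.span (\<phi> ` {1..2 * CARD('n)})"
        "\<And>p b. p \<in> \<Omega> \<Longrightarrow> xcomp Q b p - (M *v snd p) $ b = \<psi> (fst p) $ b"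
        by (rule flat_solution_extends[OF fund op con ne,
          where f = "\<lambda>b p. xcomp Q b p - (M *v snd p) $ b"])
          (use fx ftt holo_on_diff[OF X holo_on_mult_vec_nth] in blast)+
      have "Q p = vf_on \<Omega> (affine_vf c d M \<psi>) p" for p
      proof (cases "p \<in> \<Omega>")
        case True
        have "snd (Q p) $ b = (M *v snd p) $ b + \<psi> (fst p) $ b" for b
          using \<psi>(2)[OF True, of b] by (simp add: xcomp_def algebra_simps)
        then show ?thesis
          using c[OF True] True
            by (simp add: vf_on_def affine_vf_def tcomp_def prod_eq_iff vec_eq_iff split_beta)
      qed (simp add: out vf_on_def)
      then have "Q = vf_on \<Omega> (affine_vf c d M \<psi>)" by blast
      with M \<psi>(1) show "Q \<in> ?R" by blast
    qed
  qed
qed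

lemma vf_X_in_span:
  assumes "\<psi> \<in> ccurve.span B"
  shows "vf_on \<Omega> (vf_X \<psi>) \<in> vf.span ((\<lambda>\<psi>. vf_on \<Omega> (vf_X \<psi>)) ` B)"
proof -
  have "module_hom curvescale vfscale (\<lambda>\<psi>. vf_on \<Omega> (vf_X \<psi>))"
    by unfold_locales
      (auto simp: vf_on_def vf_X_def curvescale_def vfscale_def pointscale_def fun_eq_iff
        zero_prod_def)
  from module_hom.span_image[OF this, of B] assms show ?thesis by auto
qed

lemma vf_H_in_span:
  assumes "A \<in> cmat.span B"
  shows "vf_on \<Omega> (vf_H A) \<in> vf.span ((\<lambda>A. vf_on \<Omega> (vf_H A)) ` B)"
proof -
  have "module_hom matscale vfscale (\<lambda>A. vf_on \<Omega> (vf_H A))"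
    by unfold_locales
      (auto simp: vf_on_def vf_H_def matscale_def vfscale_def pointscale_def fun_eq_iff
        zero_prod_def
        vec_eq_iff matrix_vector_mult_def sum_distrib_left mult.assoc distrib_right sum.distrib)
  from module_hom.span_image[OF this, of B] assms show ?thesis by auto
qed

text \<open>
  For any matrix \<open>G\<close> the field splits off a dilation with matrix \<open>G\<close>; the matrix \<open>M + 2 c G\<close> that
  is left commutes with \<open>J\<close> when \<open>M J - J M = 2 c J\<close> and \<open>J G - G J = J\<close>.
\<close>

lemma affine_vf_decompose:
  "vf_on \<Omega> (affine_vf c d M \<psi>) = vf_on \<Omega> (vf_X \<psi>) + vf_on \<Omega> (vf_H (M + matscale (2 * c) G))
    + vfscale d (vf_on \<Omega> vf_T) + vfscale c (vf_on \<Omega> (vf_D G))"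
proof -
  have "matscale (2 * c) G *v x = (2 * c) *s (G *v x)" for x
    by (simp add: vec_eq_iff matscale_def matrix_vector_mult_def sum_distrib_left mult.assoc)
  then show ?thesis
    by (auto simp: fun_eq_iff vf_on_def affine_vf_def vf_X_def vf_H_def vf_T_def vf_D_def
      vfscale_def pointscale_def
      matrix_vector_mult_add_rdistrib vec_eq_iff zero_prod_def)
qed

lemma affine_vf_decompose_0:
  "vf_on \<Omega> (affine_vf 0 d M \<psi>) = vf_on \<Omega> (vf_X \<psi>) + vf_on \<Omega> (vf_H M) + vfscale d (vf_on \<Omega> vf_T)"
  using affine_vf_decompose[of \<Omega> 0 d M \<psi> 0] by simp

lemma symmetry_algebra_subspace:
  assumes \<Omega>: "open \<Omega>" "connected \<Omega>" "\<Omega> \<noteq> {}"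
    and nonscalar: "J \<notin> cmat.span {Finite_Cartesian_Product.mat 1}"
    and fund: "fundamental_set (linear_rhs J) \<phi>"
  shows "vf.subspace (max_lie_invariance_algebra \<Omega> (linear_rhs J))"
proof (rule vf.subspaceI)
  let ?g = "max_lie_invariance_algebra \<Omega> (linear_rhs J)"
    and ?S = "ccurve.span (\<phi> ` {1..2 * CARD('a)})"
  note alg = max_lie_invariance_algebra_linear[OF assms]
  have gen: "vf_on \<Omega> (affine_vf c d M \<psi>) \<in> ?g"
    if "M ** J - J ** M = matscale (2 * c) J" "\<psi> \<in> ?S" for c d M \<psi>
    unfolding alg using that by blast
  have "vf_on \<Omega> (affine_vf 0 0 0 0) \<in> ?g"
    by (rule gen) (simp_all add: ccurve.span_zero)
  moreover have "vf_on \<Omega> (affine_vf 0 0 0 0) = (0 :: 'a vfield)"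
    by (auto simp: fun_eq_iff vf_on_def affine_vf_def zero_prod_def)
  ultimately show "0 \<in> ?g" by simp
  show "Q + R \<in> ?g" if "Q \<in> ?g" "R \<in> ?g" for Q R
  proof -
    obtain c d M \<psi> where Q: "Q = vf_on \<Omega> (affine_vf c d M \<psi>)"
      and M: "M ** J - J ** M = matscale (2 * c) J" "\<psi> \<in> ?S"
      using \<open>Q \<in> ?g\<close> unfolding alg by blast
    obtain c' d' M' \<psi>' where R: "R = vf_on \<Omega> (affine_vf c' d' M' \<psi>')"
      and M': "M' ** J - J ** M' = matscale (2 * c') J" "\<psi>' \<in> ?S"
      using \<open>R \<in> ?g\<close> unfolding alg by blast
    have "(M + M') ** J - J ** (M + M') = (M ** J - J ** M) + (M' ** J - J ** M')"
      by (simp add: matrix_mult_add_left matrix_add_ldistrib)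
    also have "\<dots> = matscale (2 * (c + c')) J"
      by (simp only: M M' distrib_left cmat.scale_left_distrib)
    finally have "vf_on \<Omega> (affine_vf (c + c') (d + d') (M + M') (\<psi> + \<psi>')) \<in> ?g"
      by (rule gen) (rule ccurve.span_add[OF M(2) M'(2)])
    moreover have "Q + R = vf_on \<Omega> (affine_vf (c + c') (d + d') (M + M') (\<psi> + \<psi>'))"
      by (auto simp: Q R fun_eq_iff vf_on_def affine_vf_def algebra_simps
        matrix_vector_mult_add_rdistrib)
    ultimately show ?thesis by simp
  qed
  show "vfscale r Q \<in> ?g" if mem: "Q \<in> ?g" for r Q
  proof -
    obtain c d M \<psi> where Q: "Q = vf_on \<Omega> (affine_vf c d M \<psi>)"
      and M: "M ** J - J ** M = matscale (2 * c) J" "\<psi> \<in> ?S"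
      using mem unfolding alg by blast
    have "matscale r M ** J - J ** matscale r M = matscale r (M ** J - J ** M)"
      by (simp add: matscale_mult_left matscale_mult_right cmat.scale_right_diff_distrib)
    also have "\<dots> = matscale (2 * (r * c)) J"
      by (simp only: M cmat.scale_scale mult.left_commute)
    finally have "vf_on \<Omega> (affine_vf (r * c) (r * d) (matscale r M) (curvescale r \<psi>)) \<in> ?g"
      by (rule gen) (rule ccurve.span_scale[OF M(2)])
    moreover have "vfscale r Q
      = vf_on \<Omega> (affine_vf (r * c) (r * d) (matscale r M) (curvescale r \<psi>))"
      by (auto simp: Q fun_eq_iff vf_on_def affine_vf_def vfscale_def pointscale_def
        curvescale_def vec_eq_iff
          matscale_def matrix_vector_mult_def sum_distrib_left algebra_simps zero_prod_def)
    ultimately show ?thesis by simp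
  qed
qed

theorem theorem1:
  fixes pos :: "'n::finite \<Rightarrow> nat"
    and bl :: "(nat \<times> complex) list"
    and J :: "complex^'n^'n"
    and \<phi> :: "nat \<Rightarrow> complex \<Rightarrow> complex^'n"
    and N :: nat
    and H :: "nat \<Rightarrow> complex^'n^'n"
    and \<Omega> :: "(complex \<times> (complex^'n)) set"
  assumes "CARD('n) \<ge> 2"
    and "bij_betw pos UNIV {..<CARD('n)}"
    and "\<forall>(k, lam)\<in>set bl. k \<ge> 1"
    and "sum_list (map fst bl) = CARD('n)"
    and "J = jordan_form pos bl"
    and "J \<notin> cmat.span {Finite_Cartesian_Product.mat 1}"
    and "fundamental_set (linear_rhs J) \<phi>"
    and "commutant_basis J N H"
    and "open \<Omega>" and "connected \<Omega>" and "\<Omega> \<noteq> {}"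
  shows
    "(\<not> nilpotent_matrix J \<longrightarrow>
        max_lie_invariance_algebra \<Omega> (linear_rhs J) =
        vf.span (vf_on \<Omega> ` ((\<lambda>m. vf_X (\<phi> m)) ` {1..2 * CARD('n)} \<union>
                            (\<lambda>l. vf_H (H l)) ` {1..N} \<union> {vf_T}))) \<and>
     (nilpotent_matrix J \<longrightarrow>
        max_lie_invariance_algebra \<Omega> (linear_rhs J) =
        vf.span (vf_on \<Omega> ` ((\<lambda>m. vf_X (\<phi> m)) ` {1..2 * CARD('n)} \<union>
                            (\<lambda>l. vf_H (H l)) ` {1..N} \<union> {vf_T, vf_D (gamma_matrix pos bl)})))"
proof -
  let ?g = "max_lie_invariance_algebra \<Omega> (linear_rhs J)"
  let ?G = "gamma_matrix pos bl"
  define B where "B = (\<lambda>m. vf_X (\<phi> m)) ` {1..2 * CARD('n)} \<union> (\<lambda>l. vf_H (H l)) ` {1..N} \<union> {vf_T}"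
  note fund = assms(7) and \<Omega> = assms(9-11)
  note alg = max_lie_invariance_algebra_linear[OF \<Omega> assms(6) fund]
  have sub: "vf.subspace ?g" by (rule symmetry_algebra_subspace[OF \<Omega> assms(6) fund])
  have comm: "cmat.span (H ` {1..N}) = {A. A ** J = J ** A}"
    using assms(8) by (simp add: commutant_basis_def)
  have gen: "vf_on \<Omega> (affine_vf c d M \<psi>) \<in> ?g"
    if "M ** J - J ** M = matscale (2 * c) J" "\<psi> \<in> ccurve.span (\<phi> ` {1..2 * CARD('n)})" for c d M \<psi>
    unfolding alg using that by blast
  have B_sub: "vf_on \<Omega> ` B \<subseteq> ?g"
  proof -
    have "vf_on \<Omega> (vf_X (\<phi> m)) \<in> ?g" if "m \<in> {1..2 * CARD('n)}" for m
    proof -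
      have "vf_X (\<phi> m) = affine_vf 0 0 0 (\<phi> m)"
        by (auto simp: vf_X_def affine_vf_def fun_eq_iff)
      moreover have "\<phi> m \<in> ccurve.span (\<phi> ` {1..2 * CARD('n)})"
        by (rule ccurve.span_base[OF imageI[OF that]])
      ultimately show ?thesis using gen[of 0 0 "\<phi> m" 0] by simp
    qed
    moreover have "vf_on \<Omega> (vf_H (H l)) \<in> ?g" if "l \<in> {1..N}" for l
    proof -
      have "vf_H (H l) = affine_vf 0 0 (H l) 0"
        by (auto simp: vf_H_def affine_vf_def fun_eq_iff)
      moreover have "H l ** J = J ** H l"
        using cmat.span_base[OF imageI[OF that, of H]] unfolding comm by (rule CollectD)
      ultimately show ?thesis using gen[of "H l" 0 0 0] by (simp add: ccurve.span_zero)
    qed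
    moreover have "vf_on \<Omega> vf_T \<in> ?g"
    proof -
      have "vf_T = affine_vf 0 1 (0 :: complex^'n^'n) 0"
        by (auto simp: vf_T_def affine_vf_def fun_eq_iff)
      then show ?thesis using gen[of 0 0 0 1] by (simp add: ccurve.span_zero)
    qed
    ultimately show ?thesis unfolding B_def by blast
  qed
  have X_span: "vf_on \<Omega> (vf_X \<psi>) \<in> vf.span (vf_on \<Omega> ` B)"
    if "\<psi> \<in> ccurve.span (\<phi> ` {1..2 * CARD('n)})" for \<psi>
    by (rule subsetD[OF vf.span_mono vf_X_in_span[OF that]]) (auto simp: B_def)
  have H_span: "vf_on \<Omega> (vf_H A) \<in> vf.span (vf_on \<Omega> ` B)" if "A ** J = J ** A" for A
  proof -
    have "A \<in> cmat.span (H ` {1..N})" unfolding comm using that by (rule CollectI)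
    then show ?thesis
      by (rule subsetD[OF vf.span_mono vf_H_in_span, rotated]) (auto simp: B_def)
  qed
  have T_span: "vf_on \<Omega> vf_T \<in> vf.span (vf_on \<Omega> ` B)"
    by (rule vf.span_base) (simp add: B_def)
  have "?g = vf.span (vf_on \<Omega> ` B)" if nn: "\<not> nilpotent_matrix J"
  proof
    show "vf.span (vf_on \<Omega> ` B) \<subseteq> ?g" by (rule vf.span_minimal[OF B_sub sub])
    show "?g \<subseteq> vf.span (vf_on \<Omega> ` B)"
    proof
      fix Q assume "Q \<in> ?g"
      then obtain c d M \<psi> where Q: "Q = vf_on \<Omega> (affine_vf c d M \<psi>)"
        and M: "M ** J - J ** M = matscale (2 * c) J"
          and \<psi>: "\<psi> \<in> ccurve.span (\<phi> ` {1..2 * CARD('n)})"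
        unfolding alg by blast
      have c: "c = 0" using nilpotent_if_commutator[OF M] nn by auto
      with M have "M ** J = J ** M" by simp
      then show "Q \<in> vf.span (vf_on \<Omega> ` B)"
        unfolding Q c affine_vf_decompose_0
        by (intro vf.span_add vf.span_scale X_span[OF \<psi>] H_span T_span)
    qed
  qed
  moreover have "?g = vf.span (vf_on \<Omega> ` (B \<union> {vf_D ?G}))" if nil: "nilpotent_matrix J"
  proof
    let ?D = "vf_on \<Omega> ` (B \<union> {vf_D ?G})"
    have mono: "vf.span (vf_on \<Omega> ` B) \<subseteq> vf.span ?D" by (rule vf.span_mono) auto
    have JG: "J ** ?G - ?G ** J = J"
      using gamma_commutator[OF assms(2,4)] nil unfolding assms(5) .
    have "vf_on \<Omega> (vf_D ?G) \<in> ?g"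
    proof -
      have "vf_D ?G = affine_vf 1 0 (matscale (-2) ?G) 0"
        by (auto simp: vf_D_def affine_vf_def fun_eq_iff vec_eq_iff matscale_def
          matrix_vector_mult_def
            sum_distrib_left mult.assoc sum_negf)
      moreover have "matscale (-2) ?G ** J - J ** matscale (-2) ?G = matscale 2 (J ** ?G - ?G ** J)"
        unfolding matscale_mult_left matscale_mult_right
          by (simp add: matscale_def vec_eq_iff algebra_simps)
      ultimately show ?thesis
        by (auto simp: JG intro!: gen ccurve.span_zero)
    qed
    then show "vf.span ?D \<subseteq> ?g" using B_sub by (intro vf.span_minimal sub) auto
    show "?g \<subseteq> vf.span ?D"
    proof
      fix Q assume "Q \<in> ?g"
      then obtain c d M \<psi> where Q: "Q = vf_on \<Omega> (affine_vf c d M \<psi>)"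
        and M: "M ** J - J ** M = matscale (2 * c) J"
          and \<psi>: "\<psi> \<in> ccurve.span (\<phi> ` {1..2 * CARD('n)})"
        unfolding alg by blast
      let ?A = "M + matscale (2 * c) ?G"
      have "?A ** J - J ** ?A = (M ** J - J ** M) - matscale (2 * c) (J ** ?G - ?G ** J)"
        unfolding matrix_mult_add_left matrix_add_ldistrib matscale_mult_left matscale_mult_right
        by (simp add: matscale_def vec_eq_iff algebra_simps)
      then have "?A ** J = J ** ?A" by (simp add: M JG)
      then have "vf_on \<Omega> (vf_H ?A) \<in> vf.span ?D" using H_span mono by blast
      moreover have "vf_on \<Omega> (vf_D ?G) \<in> vf.span ?D" by (rule vf.span_base) simp
      ultimately show "Q \<in> vf.span ?D"
        unfolding Q affine_vf_decompose[of \<Omega> c d M \<psi> ?G]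
        using X_span[OF \<psi>] T_span mono by (blast intro: vf.span_add vf.span_scale)
    qed
  qed
  ultimately show ?thesis
    unfolding B_def by (simp add: insert_commute Un_assoc)
qed

end
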